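(* Let $\mathcal{A}=\mathcal{A}_{\mathbb{A}}(\mathcal{M})$ be a cluster algebra of rank $n$ associated with an exchange pattern $\mathcal{M}$ on $\mathbb{T}_n$ with coefficients in $\mathbb{P}$. Then any cluster variable is expressed in terms of any given cluster as a Laurent polynomial with coefficients in the group ring $\mathbb{Z}\mathbb{P}$; that is, for all vertices $t_0,t\in\mathbb{T}_n$ and all $j\in I$, the element $x_j(t)$ of the ambient field $\mathcal{F}$ belongs to $\mathbb{Z}\mathbb{P}[x_i(t_0)^{\pm1}: i\in I]$.
   Context: Let $I$ be a finite set of size $n$. $\mathbb{T}_n$ is the $n$-regular tree whose edges are labeled by elements of $I$ so that the $n$ edges at each vertex have different labels; write $t \overset{j}{-} t'$ if $t,t'$ are joined by an edge labeled $j$. Let $\mathbb{P}$ (the coefficient group) be a torsion-free abelian group, written multiplicatively; $\mathbb{Z}\mathbb{P}$ is its integral group ring (a domain). An exchange pattern on $\mathbb{T}_n$ with coefficients in $\mathbb{P}$ is a family $\mathcal{M}=(M_j(t))_{t\in\mathbb{T}_n,\,j\in I}$ of monomials $M_j(t)=p_j(t)\prod_{i\in I}x_i^{b_i}$ in commuting variables $x_i$ ($i\in I$), with $p_j(t)\in\mathbb{P}$ and nonnegative integer exponents $b_i$ (depending on $j,t$), such that: (E1) $x_j\nmid M_j(t)$ for all $t,j$; (E2) if $t_1\overset{j}{-}t_2$ and $x_i\mid M_j(t_1)$, then $x_i\nmid M_j(t_2)$; (E3) if $t_1\overset{i}{-}t_2\overset{j}{-}t_3$ with $i\ne j$, then $x_j\mid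 M_i(t_1)$ if and only if $x_i\mid M_j(t_2)$; (E4) if $t_1\overset{i}{-}t_2\overset{j}{-}t_3\overset{i}{-}t_4$ with $i\neq j$, then $\frac{M_i(t_3)}{M_i(t_4)}=\frac{M_i(t_2)}{M_i(t_1)}\Big|_{x_j\leftarrow M_0/x_j}$, where $M_0=(M_j(t_2)+M_j(t_3))|_{x_i=0}$. Here $F|_{x\leftarrow g}$ is the result of substituting $g$ for $x$ in $F$. To each vertex $t$ associate a cluster of $n$ variables $\mathbf{x}(t)=(x_i(t))_{i\in I}$, and let $\mathcal{F}(t)$ be the field of rational functions in $x_i(t)$, $i\in I$, with coefficients in $\mathbb{Z}\mathbb{P}$. For every edge $t\overset{j}{-}t'$ put $P=M_j(t)+M_j(t')$ (which does not involve $x_j$) and define the $\mathbb{Z}\mathbb{P}$-linear field isomorphism $R_{tt'}:\mathcal{F}(t')\to\mathcal{F}(t)$ by $R_{tt'}(x_i(t'))=x_i(t)$ for $i\ne j$ and $R_{tt'}(x_j(t'))=P(\mathbf{x}(t))/x_j(t)$. One has $R_{t't}=R_{tt'}^{-1}$, and these maps are used to identify all $\mathcal{F}(t)$ with a single ambient field $\mathcal{F}$ containing all cluster variables $x_i(t)$. Thus in $\mathcal{F}$, for each edge $t\overset{j}{-}t'$: $x_i(t)=x_i(t')$ for $i\neq j$, and $x_j(t)x_j(t')=M_j(t)(\mathbf{x}(t))+M_j(t')(\mathbf{x}(t'))$. For a subring with unit $\mathbb{A}\subset\mathbb{Z}\mathbb{P}$ containing all the coefficients $p_i(t)$, the cluster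 algebra $\mathcal{A}_{\mathbb{A}}(\mathcal{M})$ of rank $n$ is the $\mathbb{A}$-subalgebra with unit of $\mathcal{F}$ generated by all cluster variables $x_i(t)$, $i\in I$, $t\in\mathbb{T}_n$. *)

theory Defs
  imports Complex_Main "HOL-Library.Poly_Mapping"
begin

section \<open>The coefficient group and its group ring\<close>

text \<open>
  The coefficient group is written additively, because the type \<open>'p \<Rightarrow>\<^sub>0 int\<close>
  of finitely supported functions carries the convolution product for an additive \<open>'p\<close>: it
  is the integral group ring of \<open>'p\<close>, and \<open>Poly_Mapping.single p 1\<close> is the group element \<open>p\<close>
  inside the group ring.
\<close>

class torsion_free_ab_group_add = ab_group_add +
  assumes torsion_free: "0 < m \<Longrightarrow> (\<Sum>k<(m::nat). a) = 0 \<Longrightarrow> a = 0"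

type_synonym 'p group_ring = "'p \<Rightarrow>\<^sub>0 int"

definition ring_morphism :: "('a::ring_1 \<Rightarrow> 'b::ring_1) \<Rightarrow> bool" where
  "ring_morphism f \<longleftrightarrow>
     f 1 = 1 \<and> (\<forall>a b. f (a + b) = f a + f b) \<and> (\<forall>a b. f (a * b) = f a * f b)"

definition unital_subring :: "'a::ring_1 set \<Rightarrow> bool" where
  "unital_subring S \<longleftrightarrow>
     0 \<in> S \<and> 1 \<in> S \<and>
     (\<forall>a\<in>S. \<forall>b\<in>S. a + b \<in> S) \<and> (\<forall>a\<in>S. - a \<in> S) \<and> (\<forall>a\<in>S. \<forall>b\<in>S. a * b \<in> S)"


section \<open>The regular tree with labelled edges\<close>

text \<open>\<open>edge t j t'\<close> means that \<open>t\<close> and \<open>t'\<close> are joined by an edge labelled \<open>j\<close>.\<close>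

definition adjacent :: "('v \<Rightarrow> 'i \<Rightarrow> 'v \<Rightarrow> bool) \<Rightarrow> 'v \<Rightarrow> 'v \<Rightarrow> bool" where
  "adjacent edge t t' \<longleftrightarrow> (\<exists>j. edge t j t')"

definition is_cycle :: "('v \<Rightarrow> 'i \<Rightarrow> 'v \<Rightarrow> bool) \<Rightarrow> 'v list \<Rightarrow> bool" where
  "is_cycle edge c \<longleftrightarrow>
     3 \<le> length c \<and> distinct c \<and>
     (\<forall>k<length c. adjacent edge (c ! k) (c ! (Suc k mod length c)))"

locale labelled_regular_tree =
  fixes edge :: "'v \<Rightarrow> 'i::finite \<Rightarrow> 'v \<Rightarrow> bool"
  assumes edge_sym: "edge t j t' \<Longrightarrow> edge t' j t"
    and no_loop: "\<not> edge t j t"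
    and one_label: "edge t i t' \<Longrightarrow> edge t j t' \<Longrightarrow> i = j"
    and regular: "\<exists>!t'. edge t j t'"
    and connected: "(adjacent edge)\<^sup>*\<^sup>* s t"
    and acyclic: "\<not> is_cycle edge c"


section \<open>Monomials, polynomials and rational functions\<close>

text \<open>The pair \<open>(p, b)\<close> stands for the monomial with coefficient \<open>p\<close> and exponents \<open>b i\<close>.\<close>

type_synonym ('p, 'i) monomial = "'p \<times> ('i \<Rightarrow>\<^sub>0 nat)"

definition var_dvd :: "'i \<Rightarrow> ('p, 'i) monomial \<Rightarrow> bool" where
  "var_dvd i M \<longleftrightarrow> 0 < Poly_Mapping.lookup (snd M) i"

definition power_product :: "('i::finite \<Rightarrow> 'f::field) \<Rightarrow> ('i \<Rightarrow>\<^sub>0 nat) \<Rightarrow> 'f" where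
  "power_product y b = (\<Prod>i\<in>UNIV. y i ^ Poly_Mapping.lookup b i)"

definition monomial_at ::
  "('p::ab_group_add group_ring \<Rightarrow> 'f::field) \<Rightarrow> ('i::finite \<Rightarrow> 'f) \<Rightarrow> ('p, 'i) monomial \<Rightarrow> 'f"
  where "monomial_at \<iota> y M = \<iota> (Poly_Mapping.single (fst M) 1) * power_product y (snd M)"

text \<open>Polynomials in variables indexed by \<open>'i\<close> over the group ring, and their value at \<open>y\<close>.\<close>

type_synonym ('p, 'i) polynomial = "('i \<Rightarrow>\<^sub>0 nat) \<Rightarrow>\<^sub>0 'p group_ring"

definition poly_at ::
  "('p::ab_group_add group_ring \<Rightarrow> 'f::field) \<Rightarrow> ('i::finite \<Rightarrow> 'f) \<Rightarrow> ('p, 'i) polynomial \<Rightarrow> 'f"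
  where "poly_at \<iota> y Q =
    (\<Sum>b\<in>Poly_Mapping.keys Q. \<iota> (Poly_Mapping.lookup Q b) * power_product y b)"

text \<open>
  The field \<open>'f\<close>, together with the embedding \<open>\<iota>\<close> of the coefficients and the variables \<open>X\<close>, is
  the field of rational functions in \<open>X\<close> over the group ring: the polynomials in \<open>X\<close> embed
  (by \<open>free\<close>; applied to constant polynomials, this makes \<open>\<iota>\<close> injective), and
  \<open>'f\<close> is their field of fractions.
\<close>

locale rational_function_field =
  fixes \<iota> :: "'p::ab_group_add group_ring \<Rightarrow> 'f::field"
    and X :: "'i::finite \<Rightarrow> 'f"
  assumes coefficient_embedding: "ring_morphism \<iota>"
    and free: "inj (poly_at \<iota> X)"
    and fractions: "\<exists>Q S. poly_at \<iota> X S \<noteq> 0 \<and> f = poly_at \<iota> X Q / poly_at \<iota> X S"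


section \<open>Exchange patterns\<close>

text \<open>
  \<open>M t j\<close> is the monomial attached to the vertex \<open>t\<close> and the label \<open>j\<close>. The last axiom is an
  identity between rational functions in the indeterminates \<open>X\<close>; substitution is evaluation at a
  modified tuple of arguments. The monomials \<open>M t\<^sub>2 j\<close> and \<open>M t\<^sub>3 j\<close> cannot both be divisible
  by the \<open>i\<close>-th variable, so \<open>M0\<close> is nonzero and the substitution is legitimate.
\<close>

locale exchange_pattern =
  fixes edge :: "'v \<Rightarrow> 'i::finite \<Rightarrow> 'v \<Rightarrow> bool"
    and \<iota> :: "'p::ab_group_add group_ring \<Rightarrow> 'f::field"
    and X :: "'i \<Rightarrow> 'f"
    and M :: "'v \<Rightarrow> 'i \<Rightarrow> ('p, 'i) monomial"
  assumes E1: "\<not> var_dvd j (M t j)"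
    and E2: "edge t\<^sub>1 j t\<^sub>2 \<Longrightarrow> var_dvd i (M t\<^sub>1 j) \<Longrightarrow> \<not> var_dvd i (M t\<^sub>2 j)"
    and E3: "edge t\<^sub>1 i t\<^sub>2 \<Longrightarrow> edge t\<^sub>2 j t\<^sub>3 \<Longrightarrow> i \<noteq> j \<Longrightarrow>
      var_dvd j (M t\<^sub>1 i) \<longleftrightarrow> var_dvd i (M t\<^sub>2 j)"
    and E4: "edge t\<^sub>1 i t\<^sub>2 \<Longrightarrow> edge t\<^sub>2 j t\<^sub>3 \<Longrightarrow> edge t\<^sub>3 i t\<^sub>4 \<Longrightarrow> i \<noteq> j \<Longrightarrow>
      M0 = monomial_at \<iota> (X(i := 0)) (M t\<^sub>2 j) + monomial_at \<iota> (X(i := 0)) (M t\<^sub>3 j) \<Longrightarrow>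
      monomial_at \<iota> X (M t\<^sub>3 i) / monomial_at \<iota> X (M t\<^sub>4 i) =
      monomial_at \<iota> (X(j := M0 / X j)) (M t\<^sub>2 i) / monomial_at \<iota> (X(j := M0 / X j)) (M t\<^sub>1 i)"


section \<open>The ambient field and cluster algebras\<close>

text \<open>
  The field attached to each vertex is a copy of one field \<open>'f\<close> of rational functions, \<open>X i\<close>
  in the copy at \<open>t\<close> being the \<open>i\<close>-th variable of the cluster at \<open>t\<close>. The map \<open>R t t'\<close> goes from
  the copy at \<open>t'\<close> to the copy at \<open>t\<close>.
\<close>

locale transition_maps =
  fixes edge :: "'v \<Rightarrow> 'i::finite \<Rightarrow> 'v \<Rightarrow> bool"
    and \<iota> :: "'p::ab_group_add group_ring \<Rightarrow> 'f::field"
    and X :: "'i \<Rightarrow> 'f"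
    and M :: "'v \<Rightarrow> 'i \<Rightarrow> ('p, 'i) monomial"
    and R :: "'v \<Rightarrow> 'v \<Rightarrow> 'f \<Rightarrow> 'f"
  assumes R_morphism: "edge t j t' \<Longrightarrow> ring_morphism (R t t')"
    and R_bij: "edge t j t' \<Longrightarrow> bij (R t t')"
    and R_linear: "edge t j t' \<Longrightarrow> R t t' (\<iota> a) = \<iota> a"
    and R_other: "edge t j t' \<Longrightarrow> i \<noteq> j \<Longrightarrow> R t t' (X i) = X i"
    and R_exchange: "edge t j t' \<Longrightarrow>
      R t t' (X j) = (monomial_at \<iota> X (M t j) + monomial_at \<iota> X (M t' j)) / X j"

text \<open>
  The ambient field \<open>'k\<close>, with coefficients embedded by \<open>\<kappa>\<close>: the isomorphism \<open>\<phi> t\<close> identifies the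
  copy at \<open>t\<close> with \<open>'k\<close>, and these identifications are compatible with the transition maps.
\<close>

locale ambient_field =
  fixes edge :: "'v \<Rightarrow> 'i::finite \<Rightarrow> 'v \<Rightarrow> bool"
    and \<iota> :: "'p::ab_group_add group_ring \<Rightarrow> 'f::field"
    and R :: "'v \<Rightarrow> 'v \<Rightarrow> 'f \<Rightarrow> 'f"
    and \<kappa> :: "'p group_ring \<Rightarrow> 'k::field"
    and \<phi> :: "'v \<Rightarrow> 'f \<Rightarrow> 'k"
  assumes \<phi>_morphism: "ring_morphism (\<phi> t)"
    and \<phi>_bij: "bij (\<phi> t)"
    and \<phi>_linear: "\<phi> t (\<iota> a) = \<kappa> a"
    and \<phi>_transition: "edge t j t' \<Longrightarrow> \<phi> t (R t t' f) = \<phi> t' f"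

definition cluster_variable :: "('i \<Rightarrow> 'f) \<Rightarrow> ('v \<Rightarrow> 'f \<Rightarrow> 'k) \<Rightarrow> 'v \<Rightarrow> 'i \<Rightarrow> 'k" where
  "cluster_variable X \<phi> t i = \<phi> t (X i)"

definition cluster_algebra ::
  "('p::ab_group_add group_ring \<Rightarrow> 'k::field) \<Rightarrow> 'p group_ring set \<Rightarrow> ('v \<Rightarrow> 'i \<Rightarrow> 'k) \<Rightarrow> 'k set"
  where "cluster_algebra \<kappa> \<A> x = unital_subring hull (\<kappa> ` \<A> \<union> {x t i | t i. True})"

definition laurent_ring ::
  "('p::ab_group_add group_ring \<Rightarrow> 'k::field) \<Rightarrow> ('i \<Rightarrow> 'k) \<Rightarrow> 'k set"
  where "laurent_ring \<kappa> y =
    unital_subring hull (range \<kappa> \<union> range y \<union> range (\<lambda>i. inverse (y i)))"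

end

theory Submission
  imports Defs "HOL-Library.Function_Algebras" "HOL-Library.Product_Plus"
    "HOL-Computational_Algebra.Fraction_Field"
begin

text \<open>
  A cluster is encoded as a character \<open>\<chi>\<close> of the group of Laurent monomials: its evaluation
  \<open>ev \<chi>\<close> maps the group ring onto the Laurent ring of the cluster, and mutation multiplies
  \<open>\<chi>\<close> by a power of \<open>P / x\<^sub>i\<^sup>2\<close>.

  If \<open>t\<^sub>0\<close> and \<open>t\<close> are joined by a walk with labels \<open>i, j, w\<close>, then by induction \<open>x\<^sub>k(t)\<close> is a
  Laurent polynomial in the cluster reached from \<open>t\<^sub>0\<close> by \<open>i\<close> (from which \<open>j, w\<close> leads to \<open>t\<close>) and in
  the one reached by \<open>i, j, i\<close> (from which \<open>i, w\<close> leads to \<open>t\<close>). The first fact allows only powers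
  of \<open>P = M\<^sub>i(t\<^sub>0) + M\<^sub>i(t\<^sub>1)\<close> as denominators, the second only products of elements that are not
  zero divisors modulo \<open>P\<close>, so there is no denominator at all.

  This regularity may fail when \<open>P\<close> and the exchange polynomial of \<open>x\<^sub>j\<close> have a common factor. Hence the
  pattern is first deformed by generic coefficients, for which the two polynomials are separated
  by a grading; the expansions of the deformed pattern then specialize to the given one.
\<close>

section \<open>Natural multiples in commutative monoids\<close>

primrec nmul :: "nat \<Rightarrow> 'a::comm_monoid_add \<Rightarrow> 'a" where
  "nmul 0 a = 0"
| "nmul (Suc n) a = a + nmul n a"

lemma nmul_int [simp]: "nmul n (a::int) = int n * a"
  by (induction n) (simp_all add: algebra_simps)

lemma fst_nmul [simp]: "fst (nmul n a) = nmul n (fst a)"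
  by (induction n) simp_all

lemma snd_nmul [simp]: "snd (nmul n a) = nmul n (snd a)"
  by (induction n) simp_all

lemma nmul_fun_apply [simp]: "nmul n f x = nmul n (f x)"
  by (induction n) simp_all

lemma (in additive) nmul: "f (nmul n a) = nmul n (f a)"
  by (induction n) (simp_all add: add zero)

lemma frag_of_add: "frag_of (a + b) = frag_of a * frag_of b"
  by (simp add: mult_single)

lemma frag_of_nmul: "frag_of (nmul n a) = frag_of a ^ n"
  by (induction n) (simp_all add: frag_of_add del: One_nat_def)

section \<open>Group rings and their evaluations\<close>

lemma poly_mapping_sum_single:
  "f = (\<Sum>g\<in>Poly_Mapping.keys f. Poly_Mapping.single g (Poly_Mapping.lookup f g))"
  by (rule poly_mapping_eqI)
    (simp add: lookup_sum lookup_single when_def not_in_keys_iff_lookup_eq_zero)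

text \<open>The additive extension of \<chi> to the group ring; for a character it is a ring
  homomorphism.\<close>

definition ev :: "('g \<Rightarrow> 'a::comm_ring_1) \<Rightarrow> ('g \<Rightarrow>\<^sub>0 int) \<Rightarrow> 'a" where
  "ev \<chi> f = (\<Sum>g\<in>Poly_Mapping.keys f. of_int (Poly_Mapping.lookup f g) * \<chi> g)"

lemma ev_superset:
  assumes "finite S" "Poly_Mapping.keys f \<subseteq> S"
  shows "ev \<chi> f = (\<Sum>g\<in>S. of_int (Poly_Mapping.lookup f g) * \<chi> g)"
  unfolding ev_def using assms
  by (intro sum.mono_neutral_left) (auto simp: not_in_keys_iff_lookup_eq_zero)

lemma ev_zero [simp]: "ev \<chi> 0 = 0"
  by (simp add: ev_def)

lemma ev_single [simp]: "ev \<chi> (Poly_Mapping.single g a) = of_int a * \<chi> g"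
  by (simp add: ev_def)

lemma ev_add: "ev \<chi> (f + g) = ev \<chi> f + ev \<chi> g"
proof -
  let ?S = "Poly_Mapping.keys f \<union> Poly_Mapping.keys g"
  have "ev \<chi> (f + g) = (\<Sum>h\<in>?S. of_int (Poly_Mapping.lookup (f + g) h) * \<chi> h)"
    by (rule ev_superset) (simp_all add: keys_add)
  also have "\<dots> = (\<Sum>h\<in>?S. of_int (Poly_Mapping.lookup f h) * \<chi> h) +
      (\<Sum>h\<in>?S. of_int (Poly_Mapping.lookup g h) * \<chi> h)"
    by (simp add: lookup_add algebra_simps sum.distrib)
  also have "\<dots> = ev \<chi> f + ev \<chi> g"
    by (simp add: ev_superset[of ?S])
  finally show ?thesis .
qed

lemma ev_sum: "ev \<chi> (sum f A) = (\<Sum>a\<in>A. ev \<chi> (f a))"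
  by (induction A rule: infinite_finite_induct) (simp_all add: ev_add)

lemma ev_uminus: "ev \<chi> (- f) = - ev \<chi> f"
  by (metis add.right_inverse add_eq_0_iff ev_add ev_zero)

lemma ev_diff: "ev \<chi> (f - g) = ev \<chi> f - ev \<chi> g"
  by (metis ev_add ev_uminus uminus_add_conv_diff add.commute)

definition character :: "('g::ab_group_add \<Rightarrow> 'a::comm_ring_1) \<Rightarrow> bool" where
  "character \<chi> \<longleftrightarrow> \<chi> 0 = 1 \<and> (\<forall>g h. \<chi> (g + h) = \<chi> g * \<chi> h)"

lemma character_zero: "character \<chi> \<Longrightarrow> \<chi> 0 = 1"
  and character_add: "character \<chi> \<Longrightarrow> \<chi> (g + h) = \<chi> g * \<chi> h"
  by (simp_all add: character_def)

lemma character_nonzero: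
  fixes \<chi> :: "'g::ab_group_add \<Rightarrow> 'a::field"
  assumes "character \<chi>"
  shows "\<chi> g \<noteq> 0"
  by (metis add.right_inverse assms character_def mult_zero_left zero_neq_one)

lemma character_diff:
  fixes \<chi> :: "'g::ab_group_add \<Rightarrow> 'a::field"
  assumes "character \<chi>"
  shows "\<chi> (g - h) = \<chi> g / \<chi> h"
  using character_add[OF assms, of "g - h" h] character_nonzero[OF assms, of h]
  by (simp add: field_simps)

lemma character_nmul: "character \<chi> \<Longrightarrow> \<chi> (nmul n g) = \<chi> g ^ n"
  by (induction n) (simp_all add: character_zero character_add)

lemma ev_one: "character \<chi> \<Longrightarrow> ev \<chi> 1 = 1"
  using ev_single[of \<chi> 0 1] by (simp add: character_zero)

lemma ev_mult:
  assumes "character \<chi>"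
  shows "ev \<chi> (f * g) = ev \<chi> f * ev \<chi> g"
proof -
  have "ev \<chi> (f * g) = ev \<chi> ((\<Sum>a\<in>Poly_Mapping.keys f. Poly_Mapping.single a (Poly_Mapping.lookup f a))
     * (\<Sum>b\<in>Poly_Mapping.keys g. Poly_Mapping.single b (Poly_Mapping.lookup g b)))"
    by (simp flip: poly_mapping_sum_single)
  also have "\<dots> = ev \<chi> f * ev \<chi> g"
    unfolding sum_product ev_def[of \<chi> f] ev_def[of \<chi> g]
    by (simp add: ev_sum mult_single character_add[OF assms] mult_ac)
  finally show ?thesis .
qed

lemma ev_power: "character \<chi> \<Longrightarrow> ev \<chi> (f ^ n) = ev \<chi> f ^ n"
  by (induction n) (simp_all add: ev_one ev_mult)

text \<open>Injectivity of \<open>ev \<chi>\<close> expresses that a cluster is algebraically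
  independent over the coefficients. Identities between values in a field can then be read back in
  the group ring, and cancellation can be done in the field.\<close>

definition free_character :: "('g::ab_group_add \<Rightarrow> 'a::comm_ring_1) \<Rightarrow> bool" where
  "free_character \<chi> \<longleftrightarrow> character \<chi> \<and> (\<forall>f. ev \<chi> f = 0 \<longrightarrow> f = 0)"

lemma free_characterD: "free_character \<chi> \<Longrightarrow> character \<chi>"
  by (simp add: free_character_def)

lemma free_character_ev_eq_0_iff: "free_character \<chi> \<Longrightarrow> ev \<chi> f = 0 \<longleftrightarrow> f = 0"
  by (auto simp: free_character_def)

lemma free_character_ev_inject: "free_character \<chi> \<Longrightarrow> ev \<chi> f = ev \<chi> g \<longleftrightarrow> f = g"
  by (metis ev_diff free_character_ev_eq_0_iff right_minus_eq)

lemma free_character_inject: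
  assumes "free_character \<chi>"
  shows "\<chi> g = \<chi> h \<longleftrightarrow> g = h"
proof
  assume "\<chi> g = \<chi> h"
  with assms have "frag_of g = frag_of h"
    by (simp flip: free_character_ev_inject[OF assms])
  then have "Poly_Mapping.keys (frag_of g) = Poly_Mapping.keys (frag_of h)"
    by simp
  then show "g = h"
    by simp
qed simp

lemma free_characterI:
  assumes "character \<chi>"
    and "\<And>S c. finite S \<Longrightarrow> (\<Sum>g\<in>S. of_int (c g) * \<chi> g) = 0 \<Longrightarrow> \<forall>g\<in>S. c g = 0"
  shows "free_character \<chi>"
proof -
  have "f = 0" if "ev \<chi> f = 0" for f
    using assms(2)[of "Poly_Mapping.keys f" "Poly_Mapping.lookup f"] that unfolding ev_def
    by (metis (no_types, lifting) finite_keys lookup_zero not_in_keys_iff_lookup_eq_zero poly_mapping_eqI)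
  with assms(1) show ?thesis
    by (auto simp: free_character_def)
qed

lemma free_character_independent:
  assumes "free_character \<chi>" "finite S" "(\<Sum>g\<in>S. of_int (c g) * \<chi> g) = 0" "g \<in> S"
  shows "c g = 0"
proof -
  define f where "f = (\<Sum>g\<in>S. Poly_Mapping.single g (c g))"
  have "ev \<chi> f = 0"
    using assms(3) by (simp add: f_def ev_sum)
  then have "f = 0"
    using assms(1) by (simp add: free_character_ev_eq_0_iff)
  then have "Poly_Mapping.lookup f g = 0"
    by simp
  then show ?thesis
    using assms(2,4) by (simp add: f_def lookup_sum lookup_single when_def)
qed

section \<open>Homogeneous components\<close>

definition component :: "('g \<Rightarrow> int) \<Rightarrow> int \<Rightarrow> ('g \<Rightarrow>\<^sub>0 int) \<Rightarrow> ('g \<Rightarrow>\<^sub>0 int)" where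
  "component l k f = (\<Sum>g\<in>{g \<in> Poly_Mapping.keys f. l g = k}. Poly_Mapping.single g (Poly_Mapping.lookup f g))"

lemma lookup_component:
  "Poly_Mapping.lookup (component l k f) g = (if l g = k then Poly_Mapping.lookup f g else 0)"
  unfolding component_def
  by (auto simp: lookup_sum lookup_single when_def not_in_keys_iff_lookup_eq_zero)

lemma component_zero [simp]: "component l k 0 = 0"
  by (rule poly_mapping_eqI) (simp add: lookup_component)

lemma component_add: "component l k (f + g) = component l k f + component l k g"
  by (rule poly_mapping_eqI) (simp add: lookup_component lookup_add)

lemma component_sum: "component l k (sum f A) = (\<Sum>a\<in>A. component l k (f a))"
  by (induction A rule: infinite_finite_induct) (simp_all add: component_add)

lemma component_single:
  "component l k (Poly_Mapping.single g a) = (if l g = k then Poly_Mapping.single g a else 0)"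
  by (rule poly_mapping_eqI) (auto simp: lookup_component lookup_single when_def)

lemma component_eq_0_iff: "(\<forall>k. component l k f = 0) \<longleftrightarrow> f = 0"
proof
  assume *: "\<forall>k. component l k f = 0"
  show "f = 0"
  proof (rule poly_mapping_eqI)
    fix g
    show "Poly_Mapping.lookup f g = Poly_Mapping.lookup 0 g"
      using lookup_component[of l "l g" f g] * by simp
  qed
qed simp

definition homogeneous :: "('g \<Rightarrow> int) \<Rightarrow> int \<Rightarrow> ('g \<Rightarrow>\<^sub>0 int) \<Rightarrow> bool" where
  "homogeneous l d f \<longleftrightarrow> (\<forall>g\<in>Poly_Mapping.keys f. l g = d)"

lemma homogeneous_single: "l g = d \<Longrightarrow> homogeneous l d (Poly_Mapping.single g a)"
  by (simp add: homogeneous_def)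

lemma homogeneous_add: "homogeneous l d f \<Longrightarrow> homogeneous l d g \<Longrightarrow> homogeneous l d (f + g)"
  using keys_add by (fastforce simp: homogeneous_def)

lemma homogeneous_mult:
  "additive l \<Longrightarrow> homogeneous l d f \<Longrightarrow> homogeneous l e g \<Longrightarrow> homogeneous l (d + e) (f * g)"
  using keys_mult by (fastforce simp: homogeneous_def additive.add)

lemma homogeneous_power:
  "additive l \<Longrightarrow> homogeneous l d f \<Longrightarrow> homogeneous l (int n * d) (f ^ n)"
proof (induction n)
  case (Suc n)
  then show ?case
    using homogeneous_mult[of l d f "int n * d" "f ^ n"] by (simp add: algebra_simps)
qed (simp add: homogeneous_def additive.zero)

lemma component_mult_homogeneous:
  assumes "additive l" "homogeneous l d p"
  shows "component l k (p * f) = p * component l (k - d) f"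
proof -
  have "component l k (p * f) = component l k
     ((\<Sum>a\<in>Poly_Mapping.keys p. Poly_Mapping.single a (Poly_Mapping.lookup p a))
     * (\<Sum>b\<in>Poly_Mapping.keys f. Poly_Mapping.single b (Poly_Mapping.lookup f b)))"
    by (simp flip: poly_mapping_sum_single)
  also have "\<dots> = (\<Sum>a\<in>Poly_Mapping.keys p. \<Sum>b\<in>Poly_Mapping.keys f.
      Poly_Mapping.single a (Poly_Mapping.lookup p a) *
      component l (k - d) (Poly_Mapping.single b (Poly_Mapping.lookup f b)))"
    unfolding sum_product component_sum using assms
    by (intro sum.cong refl) (auto simp: mult_single component_single additive.add homogeneous_def)
  also have "\<dots> = p * component l (k - d) f"
    by (simp flip: sum_product component_sum poly_mapping_sum_single)
  finally show ?thesis .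
qed

text \<open>Group elements are units, with inverse \<open>frag_of (- g)\<close>.\<close>

lemma dvd_mult_frag_of_iff: "p dvd f * frag_of g \<longleftrightarrow> p dvd f" for g :: "'g::ab_group_add"
proof
  assume "p dvd f * frag_of g"
  then have "p dvd f * frag_of g * frag_of (- g)"
    by (rule dvd_mult2)
  then show "p dvd f"
    by (simp add: mult.assoc mult_single)
qed (rule dvd_mult2)

text \<open>Compare the components of highest degree on both sides and descend.\<close>

lemma homogeneous_dvd_mult_cancel:
  assumes l: "additive l" and p: "homogeneous l d p"
    and lower: "\<And>h. h \<in> Poly_Mapping.keys b \<Longrightarrow> l h < l g"
    and dvd: "p dvd c * (frag_of g + b)"
  shows "p dvd c"
  using dvd
proof (induction "card (Poly_Mapping.keys c)" arbitrary: c rule: less_induct)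
  case less
  show ?case
  proof (cases "c = 0")
    case False
    define k where "k = Max (l ` Poly_Mapping.keys c)"
    have keys: "Poly_Mapping.keys c \<noteq> {}"
      using False by (metis all_not_in_conv poly_mapping_eqI lookup_zero in_keys_iff)
    \<comment> \<open>The degrees in \<open>c\<close> are at most \<open>k\<close> and those in
      \<open>b\<close> are below \<open>l g\<close>, so in degree \<open>k + l g\<close> only the
      top component of \<open>c\<close> times \<open>frag_of g\<close> survives.\<close>
    have "component l (k + l g) (c * b) = 0"
    proof (rule poly_mapping_eqI)
      fix h
      have "Poly_Mapping.lookup (c * b) h = 0" if "l h = k + l g"
      proof (rule ccontr)
        assume "Poly_Mapping.lookup (c * b) h \<noteq> 0"
        then obtain x y where "h = x + y" "x \<in> Poly_Mapping.keys c" "y \<in> Poly_Mapping.keys b"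
          using keys_mult[of c b] by (auto simp: in_keys_iff)
        moreover from this have "l x \<le> k"
          by (simp add: k_def)
        ultimately show False
          using lower[of y] that by (simp add: additive.add[OF l])
      qed
      then show "Poly_Mapping.lookup (component l (k + l g) (c * b)) h = Poly_Mapping.lookup 0 h"
        by (simp add: lookup_component)
    qed
    moreover have "component l (k + l g) (c * frag_of g) = component l k c * frag_of g"
      using component_mult_homogeneous[OF l homogeneous_single[OF refl], of "k + l g" g 1 c]
      by (simp add: mult.commute)
    moreover obtain e where "c * (frag_of g + b) = p * e"
      using less.prems by blast
    ultimately have "component l k c * frag_of g = p * component l (k + l g - d) e"
      using component_mult_homogeneous[OF l p, of "k + l g" e]
      by (metis add.right_neutral component_add distrib_left)
    then have dvd_top: "p dvd component l k c"
      by (metis dvd_mult_frag_of_iff dvd_triv_left)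
    define c' where "c' = c - component l k c"
    have keys_c': "Poly_Mapping.keys c' = {h \<in> Poly_Mapping.keys c. l h \<noteq> k}"
      by (auto simp: c'_def in_keys_iff lookup_minus lookup_component split: if_splits)
    have "k \<in> l ` Poly_Mapping.keys c"
      unfolding k_def using keys by (intro Max_in) auto
    then have "Poly_Mapping.keys c' \<subset> Poly_Mapping.keys c"
      by (auto simp: keys_c')
    then have "card (Poly_Mapping.keys c') < card (Poly_Mapping.keys c)"
      by (intro psubset_card_mono) auto
    moreover have "p dvd c' * (frag_of g + b)"
      unfolding c'_def left_diff_distrib using less.prems dvd_top by (simp add: dvd_diff)
    ultimately have "p dvd c'"
      using less.hyps by blast
    from this dvd_top have "p dvd c' + component l k c"
      by (rule dvd_add)
    then show ?thesis
      by (simp add: c'_def)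
  qed simp
qed

section \<open>Twisting a character\<close>

text \<open>For \<open>l = deg i\<close> this rescales the variable x_i by \<open>r\<close> and
  fixes the other variables and the coefficients.\<close>

definition twist :: "('g \<Rightarrow> 'a::field) \<Rightarrow> 'a \<Rightarrow> ('g \<Rightarrow> int) \<Rightarrow> 'g \<Rightarrow> 'a" where
  "twist \<chi> r l g = \<chi> g * r powi l g"

lemma character_twist:
  assumes "character \<chi>" "additive l" "r \<noteq> 0"
  shows "character (twist \<chi> r l)"
  using assms
  by (simp add: character_def twist_def additive.zero additive.add power_int_add)

lemma twist_twist_inverse:
  assumes "r \<noteq> 0"
  shows "twist (twist \<chi> r l) (inverse r) l = \<chi>"
  using assms by (simp add: twist_def fun_eq_iff power_int_inverse)

lemma ev_twist_homogeneous:
  assumes "homogeneous l d f"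
  shows "ev (twist \<chi> r l) f = r powi d * ev \<chi> f"
  using assms unfolding ev_def homogeneous_def sum_distrib_left twist_def
  by (intro sum.cong) auto

lemma power_mult_power_int:
  fixes r :: "'a::field"
  assumes "r \<noteq> 0" "- e \<le> int n"
  shows "r ^ n * r powi e = r ^ nat (e + int n)"
proof -
  have "r ^ n * r powi e = r powi (int n + e)"
    using assms(1) by (simp only: power_int_add simp_thms power_int_of_nat)
  also have "int n + e = int (nat (e + int n))"
    using assms(2) by simp
  finally show ?thesis
    by (simp only: power_int_of_nat)
qed

text \<open>A term of degree e picks up the factor p^e under the twist. Once \<open>m\<close> bounds
  the negative degrees, p^m leaves only nonnegative powers of p, and these are values of elements of
  the group ring.\<close>

lemma ev_twist_clear_denominator:
  assumes "character \<chi>" "ev \<chi> p \<noteq> 0" "\<And>g. g \<in> Poly_Mapping.keys f \<Longrightarrow> - l g \<le> int m"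
  shows "ev \<chi> p ^ m * ev (twist \<chi> (ev \<chi> p) l) f =
    ev \<chi> (\<Sum>g\<in>Poly_Mapping.keys f. p ^ nat (l g + int m) * Poly_Mapping.single g (Poly_Mapping.lookup f g))"
proof -
  have "ev \<chi> p ^ m * (of_int (Poly_Mapping.lookup f g) * (\<chi> g * ev \<chi> p powi l g)) =
      ev \<chi> p ^ nat (l g + int m) * (of_int (Poly_Mapping.lookup f g) * \<chi> g)"
    if "g \<in> Poly_Mapping.keys f" for g
    unfolding power_mult_power_int[OF assms(2) assms(3)[OF that], symmetric]
    by (simp only: mult_ac)
  then show ?thesis
    unfolding ev_def[of "twist _ _ _"] sum_distrib_left ev_sum twist_def
    by (intro sum.cong refl) (simp only: ev_mult ev_power ev_single assms(1))
qed

lemma finite_bound: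
  assumes "finite S"
  shows "\<exists>m. \<forall>g\<in>S. - l g \<le> int m"
proof -
  have "- l g \<le> int (Max (insert 0 ((\<lambda>g. nat (- l g)) ` S)))" if "g \<in> S" for g
  proof -
    have "nat (- l g) \<le> Max (insert 0 ((\<lambda>g. nat (- l g)) ` S))"
      using assms that by (intro Max_ge) auto
    then show ?thesis
      by linarith
  qed
  then show ?thesis
    by blast
qed

lemma ev_twist_twist_clear_denominators:
  assumes \<chi>: "character \<chi>" and A: "ev \<chi> A \<noteq> 0" and B: "ev \<chi> B \<noteq> 0"
  shows "\<exists>m n c. ev \<chi> A ^ m * ev \<chi> B ^ n *
    ev (twist (twist \<chi> (ev \<chi> A) l) (ev \<chi> B) k) f = ev \<chi> c"
proof -
  let ?K = "Poly_Mapping.keys f"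
  obtain m n where m: "\<forall>g\<in>?K. - l g \<le> int m" and n: "\<forall>g\<in>?K. - k g \<le> int n"
    using finite_bound[of ?K] by fastforce
  define c where "c = (\<Sum>g\<in>?K. B ^ nat (k g + int n) * (A ^ nat (l g + int m) *
    Poly_Mapping.single g (Poly_Mapping.lookup f g)))"
  have "ev \<chi> A ^ m * ev \<chi> B ^ n * (of_int (Poly_Mapping.lookup f g) *
      (\<chi> g * ev \<chi> A powi l g * ev \<chi> B powi k g)) =
      ev \<chi> B ^ nat (k g + int n) * (ev \<chi> A ^ nat (l g + int m) * (of_int (Poly_Mapping.lookup f g) * \<chi> g))"
    if "g \<in> ?K" for g
    unfolding power_mult_power_int[OF A bspec[OF m that], symmetric]
      power_mult_power_int[OF B bspec[OF n that], symmetric]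
    by (simp only: mult_ac)
  then have "ev \<chi> A ^ m * ev \<chi> B ^ n *
    ev (twist (twist \<chi> (ev \<chi> A) l) (ev \<chi> B) k) f = ev \<chi> c"
    unfolding c_def ev_def[of "twist _ _ _"] sum_distrib_left ev_sum twist_def
    by (intro sum.cong refl) (simp only: ev_mult ev_power ev_single \<chi>)
  then show ?thesis
    by blast
qed

text \<open>
  Multiplying by \<open>p\<^sup>m\<close> turns the component of degree \<open>k\<close> of \<open>f\<close> into a component of degree
  \<open>- k - 2 m\<close>, so no cancellation between different components can occur.
\<close>

lemma free_character_twist:
  fixes \<chi> :: "'g::ab_group_add \<Rightarrow> 'a::field"
  assumes \<chi>: "free_character \<chi>" and l: "additive l" and p: "homogeneous l (- 2) p" "p \<noteq> 0"
  shows "free_character (twist \<chi> (ev \<chi> p) l)"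
proof -
  note \<chi>' = free_characterD[OF \<chi>]
  have nz: "ev \<chi> p \<noteq> 0"
    using p(2) \<chi> by (simp add: free_character_ev_eq_0_iff)
  have "f = 0" if "ev (twist \<chi> (ev \<chi> p) l) f = 0" for f
  proof -
    let ?K = "Poly_Mapping.keys f"
    obtain m where m: "\<forall>g\<in>?K. - l g \<le> int m"
      using finite_bound[of ?K] by fastforce
    define F where "F = (\<Sum>g\<in>?K. p ^ nat (l g + int m) * Poly_Mapping.single g (Poly_Mapping.lookup f g))"
    have "ev \<chi> F = 0"
      using ev_twist_clear_denominator[OF \<chi>' nz, of f l m] m that by (simp add: F_def)
    then have "F = 0"
      using \<chi> by (simp add: free_character_ev_eq_0_iff)
    have "component l k f = 0" for k
    proof -
      have "component l (- k - 2 * int m) F =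
        (\<Sum>g\<in>?K. p ^ nat (k + int m) * component l k (Poly_Mapping.single g (Poly_Mapping.lookup f g)))"
        unfolding F_def component_sum
      proof (intro sum.cong refl)
        fix g
        assume "g \<in> ?K"
        then have "l g + int m \<ge> 0"
          using m by fastforce
        then show "component l (- k - 2 * int m)
            (p ^ nat (l g + int m) * Poly_Mapping.single g (Poly_Mapping.lookup f g)) =
            p ^ nat (k + int m) * component l k (Poly_Mapping.single g (Poly_Mapping.lookup f g))"
          by (subst component_mult_homogeneous[OF l homogeneous_power[OF l p(1)]])
            (auto simp: component_single)
      qed
      also have "\<dots> = p ^ nat (k + int m) * component l k f"
        by (simp flip: sum_distrib_left component_sum poly_mapping_sum_single)
      finally have "p ^ nat (k + int m) * component l k f = 0"
        using \<open>F = 0\<close> by simp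
      then have "ev \<chi> p ^ nat (k + int m) * ev \<chi> (component l k f) = 0"
        by (metis ev_mult[OF \<chi>'] ev_power[OF \<chi>'] ev_zero)
      then show ?thesis
        using nz \<chi> by (simp add: free_character_ev_eq_0_iff)
    qed
    then show "f = 0"
      using component_eq_0_iff by blast
  qed
  with character_twist[OF \<chi>' l nz] show ?thesis
    by (simp add: free_character_def)
qed

section \<open>Regular elements: non-zero-divisors modulo p\<close>

definition regular :: "'a::comm_ring_1 \<Rightarrow> 'a \<Rightarrow> bool" where
  "regular p a \<longleftrightarrow> (\<forall>c. p dvd c * a \<longrightarrow> p dvd c)"

lemma regular_add_multiple: "regular p (a + p * b) \<longleftrightarrow> regular p a"
proof -
  have "p dvd c * (a + p * b) \<longleftrightarrow> p dvd c * a" for c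
    by (simp add: distrib_left dvd_add_left_iff mult.left_commute)
  then show ?thesis
    by (simp add: regular_def)
qed

lemma regular_frag_of: "regular p (frag_of g)" for g :: "'g::ab_group_add"
  by (simp add: regular_def dvd_mult_frag_of_iff)

lemma regular_frag_of_add_lower:
  assumes "additive l" "homogeneous l d p" "homogeneous l e b" "e < l g"
  shows "regular p (frag_of g + b)"
  unfolding regular_def
proof (intro allI impI)
  fix c
  assume "p dvd c * (frag_of g + b)"
  moreover have "l h < l g" if "h \<in> Poly_Mapping.keys b" for h
    using assms(3,4) that by (simp add: homogeneous_def)
  ultimately show "p dvd c"
    by (rule homogeneous_dvd_mult_cancel[OF assms(1,2), rotated])
qed

lemma regular_power: "regular p a \<Longrightarrow> regular p (a ^ n)"
proof (induction n)
  case (Suc n)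
  then show ?case
    unfolding regular_def power_Suc2 mult.assoc[symmetric] by blast
next
  case 0
  show ?case
    by (simp add: regular_def)
qed

text \<open>One factor \<open>p\<close> is split off from \<open>c\<close> at a time;
  \<open>cancel\<close> removes it from the divisibility before the induction hypothesis is applied
  to the quotient.\<close>

lemma power_dvd_cancel_regular:
  fixes p :: "'a::comm_ring_1"
  assumes "regular p a" and cancel: "\<And>x y. p * x = p * y \<Longrightarrow> x = y" and "p ^ m dvd c * a"
  shows "p ^ m dvd c"
  using assms(3)
proof (induction m arbitrary: c)
  case (Suc m)
  then have "p dvd c * a"
    by (metis dvd_mult_left power_Suc)
  then obtain d where d: "c = p * d"
    using assms(1) unfolding regular_def dvd_def by blast
  obtain e where "c * a = p ^ Suc m * e"
    using Suc.prems by (rule dvdE)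
  then have "p * (d * a) = p * (p ^ m * e)"
    by (simp add: d mult.assoc)
  then have "d * a = p ^ m * e"
    by (rule cancel)
  then have "p ^ m dvd d * a"
    by (rule dvdI)
  then have "p ^ m dvd d"
    by (rule Suc.IH)
  then show ?case
    by (simp add: d mult_dvd_mono)
qed simp

text \<open>Taylor expansion to first order. It is applied to \<open>u\<close> divisible by an
  exchange ratio p; after division by p only the linear term can matter modulo p. For
  \<open>d = 0\<close> the truncated exponent \<open>d - 1\<close> has coefficient 0.\<close>

lemma power_add_expand:
  fixes t u :: "'a::comm_ring_1"
  shows "\<exists>h. (t + u) ^ d = t ^ d + of_nat d * t ^ (d - 1) * u + u\<^sup>2 * h"
proof (induction d)
  case 0
  show ?case
    by (intro exI[of _ 0]) simp
next
  case (Suc d)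
  then obtain h where h: "(t + u) ^ d = t ^ d + of_nat d * t ^ (d - 1) * u + u\<^sup>2 * h"
    by blast
  have "t * (of_nat d * t ^ (d - 1)) = of_nat d * t ^ d"
    by (cases d) (simp_all add: mult_ac)
  then have "(t + u) ^ Suc d = t ^ Suc d + of_nat (Suc d) * t ^ (Suc d - 1) * u +
      u\<^sup>2 * (of_nat d * t ^ (d - 1) + (t + u) * h)"
    by (simp add: h algebra_simps power2_eq_square)
  then show ?case
    by blast
qed

section \<open>Mutation\<close>

text \<open>Pairs of a coefficient and an exponent function form the group of Laurent monomials,
  written additively; this element is the variable x_i.\<close>

definition unit_vector :: "'i \<Rightarrow> 'c::zero \<times> ('i \<Rightarrow> int)" where
  "unit_vector i = (0, \<lambda>k. if k = i then 1 else 0)"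

abbreviation deg :: "'i \<Rightarrow> 'c \<times> ('i \<Rightarrow> int) \<Rightarrow> int" where
  "deg i g \<equiv> snd g i"

lemma additive_deg: "additive (deg i)"
  by unfold_locales simp

lemma deg_unit_vector [simp]: "deg j (unit_vector i) = (if j = i then 1 else 0)"
  by (simp add: unit_vector_def)

lemma fst_unit_vector [simp]: "fst (unit_vector i) = 0"
  by (simp add: unit_vector_def)

definition exponent_vector :: "'c \<Rightarrow> ('i \<Rightarrow> nat) \<Rightarrow> 'c \<times> ('i \<Rightarrow> int)" where
  "exponent_vector c n = (c, \<lambda>k. int (n k))"

text \<open>\<open>mon_exchange\<close> is axiom E4 on the vertices \<open>nb i s\<close>,
  \<open>s\<close>, \<open>nb j s\<close>, \<open>nb i (nb j s)\<close>, with denominators cleared.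
  Replacing x_j by M_0/x_j multiplies a monomial by a power of M_0/x_j^2, which is \<open>h\<close>.
  If both monomials on the edge j avoid x_i, then M_0 is a binomial, but \<open>b_exchange\<close>
  makes the two multiples of \<open>h\<close> equal, so the choice of \<open>h\<close> is
  immaterial.\<close>

locale monomial_pattern =
  fixes nb :: "'i \<Rightarrow> 's \<Rightarrow> 's"
    and q :: "'s \<Rightarrow> 'i \<Rightarrow> 'c::ab_group_add"
    and b :: "'s \<Rightarrow> 'i \<Rightarrow> 'i \<Rightarrow> nat"
    and S :: "'s set"
    and mon :: "'s \<Rightarrow> 'i \<Rightarrow> 'c \<times> ('i \<Rightarrow> int)"
  assumes mon_eq: "mon s i = exponent_vector (q s i) (b s i)"
    and nb_closed: "s \<in> S \<Longrightarrow> nb i s \<in> S"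
    and nb_nb: "s \<in> S \<Longrightarrow> nb i (nb i s) = s"
    and b_self: "s \<in> S \<Longrightarrow> b s i i = 0"
    and b_disjoint: "s \<in> S \<Longrightarrow> b s i k = 0 \<or> b (nb i s) i k = 0"
    and b_exchange: "s \<in> S \<Longrightarrow> i \<noteq> j \<Longrightarrow> b s i j \<noteq> b (nb i s) i j \<Longrightarrow>
      b s j i \<noteq> 0 \<or> b (nb j s) j i \<noteq> 0"
    and mon_exchange: "s \<in> S \<Longrightarrow> i \<noteq> j \<Longrightarrow>
      h = (if b s j i = 0 then mon s j else mon (nb j s) j) - unit_vector j - unit_vector j \<Longrightarrow>
      mon (nb j s) i + mon (nb i s) i + nmul (b (nb i s) i j) h =
      mon (nb i (nb j s)) i + mon s i + nmul (b s i j) h"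
begin

lemma fst_mon [simp]: "fst (mon s i) = q s i"
  and deg_mon [simp]: "deg k (mon s i) = int (b s i k)"
  by (simp_all add: mon_eq exponent_vector_def)

text \<open>Since \<open>h\<close> has degree -2 in x_j, comparing exponents of x_j in
  \<open>mon_exchange\<close> shows that the difference of the two exponents changes sign under
  mutation at j. One member of each pair vanishes, so the difference determines the pair. For
  exchange matrices this is b_ij -> -b_ij.\<close>

lemma b_exchange_signs:
  assumes s: "s \<in> S" and ij: "i \<noteq> j"
  shows "b (nb j s) i j = b (nb i s) i j" "b (nb i (nb j s)) i j = b s i j"
proof -
  define h where "h = (if b s j i = 0 then mon s j else mon (nb j s) j) - unit_vector j - unit_vector j"
  have "deg j h = - 2"
    using b_self[OF s, of j] b_self[OF nb_closed[OF s], of j j] by (simp add: h_def)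
  then have "b (nb j s) i j + b s i j = b (nb i (nb j s)) i j + b (nb i s) i j"
    using arg_cong[OF mon_exchange[OF s ij h_def], of "deg j"] by simp
  moreover have "b (nb j s) i j = 0 \<or> b (nb i (nb j s)) i j = 0" "b s i j = 0 \<or> b (nb i s) i j = 0"
    using b_disjoint[OF nb_closed[OF s, of j], of i j] b_disjoint[OF s, of i j] by simp_all
  ultimately show "b (nb j s) i j = b (nb i s) i j" "b (nb i (nb j s)) i j = b s i j"
    by auto
qed

end

text \<open>\<open>separated\<close> supplies a grading of the coefficients in which the exchange
  polynomial of x_i is homogeneous while the two terms of that of x_j have different degrees. A
  general pattern may lack one; its deformation has it.\<close>

locale mutation_pattern = monomial_pattern nb q b S mon
  for nb :: "'i \<Rightarrow> 's \<Rightarrow> 's"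
    and q :: "'s \<Rightarrow> 'i \<Rightarrow> 'c::ab_group_add"
    and b :: "'s \<Rightarrow> 'i \<Rightarrow> 'i \<Rightarrow> nat"
    and S :: "'s set"
    and mon :: "'s \<Rightarrow> 'i \<Rightarrow> 'c \<times> ('i \<Rightarrow> int)" +
  assumes separated: "s \<in> S \<Longrightarrow> i \<noteq> j \<Longrightarrow>
      \<exists>l :: 'c \<Rightarrow> int. additive l \<and> l (q s i) = l (q (nb i s) i) \<and> l (q s j) \<noteq> l (q (nb j s) j)"
begin

text \<open>The exchange polynomial of \<open>x\<^sub>i\<close>, divided by \<open>x\<^sub>i\<^sup>2\<close>: the ratio of the new and the old variable.\<close>

definition ratio :: "'s \<Rightarrow> 'i \<Rightarrow> ('c \<times> ('i \<Rightarrow> int)) \<Rightarrow>\<^sub>0 int" where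
  "ratio s i = frag_of (mon s i - unit_vector i - unit_vector i) +
     frag_of (mon (nb i s) i - unit_vector i - unit_vector i)"

lemma ratio_nb: "s \<in> S \<Longrightarrow> ratio (nb i s) i = ratio s i"
  by (simp add: ratio_def nb_nb add.commute)

lemma ratio_nonzero: "ratio s i \<noteq> 0"
proof
  assume "ratio s i = 0"
  \<comment> \<open>The augmentation sends each monomial to 1, hence the ratio to 2, even if the two
    monomials coincide.\<close>
  then have "ev (\<lambda>_. 1 :: int) (ratio s i) = 0"
    by simp
  then show False
    by (simp add: ratio_def ev_add)
qed

lemma homogeneous_ratio:
  assumes "s \<in> S"
  shows "homogeneous (deg i) (- 2) (ratio s i)"
  unfolding ratio_def
  by (intro homogeneous_add homogeneous_single)
    (simp_all add: b_self[OF assms] b_self[OF nb_closed[OF assms]])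

text \<open>\<open>x\<^sub>j' / x\<^sub>j\<close> after the mutations \<open>i\<close>, \<open>j\<close>, in terms of the cluster at \<open>s\<close>.\<close>

definition ratio2 :: "'s \<Rightarrow> 'i \<Rightarrow> 'i \<Rightarrow> ('c \<times> ('i \<Rightarrow> int)) \<Rightarrow>\<^sub>0 int" where
  "ratio2 s i j =
    (let t = nb i s; u = nb j t in
     frag_of (mon t j - unit_vector j - unit_vector j) * ratio s i ^ b t j i +
     frag_of (mon u j - unit_vector j - unit_vector j) * ratio s i ^ b u j i)"

text \<open>At most one of the two terms carries a positive power of the ratio p at
  \<open>s\<close>. If one does, \<open>ratio2\<close> is a monomial modulo p, hence a unit there.
  If none does, the grading from \<open>separated\<close> makes p homogeneous and gives
  \<open>ratio2\<close> a single leading monomial.\<close>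

lemma regular_ratio2:
  assumes s: "s \<in> S" and ij: "i \<noteq> j"
  shows "regular (ratio s i) (ratio2 s i j)"
proof -
  define t where "t = nb i s"
  define u where "u = nb j t"
  define p where "p = ratio s i"
  have t: "t \<in> S" and nb_t: "nb i t = s"
    using s by (simp_all add: t_def nb_closed nb_nb)
  let ?g = "mon t j - unit_vector j - unit_vector j"
  let ?h = "mon u j - unit_vector j - unit_vector j"
  have eq: "ratio2 s i j = frag_of ?g * p ^ b t j i + frag_of ?h * p ^ b u j i"
    by (simp add: ratio2_def t_def u_def p_def Let_def)
  have "b t j i = 0 \<or> b u j i = 0"
    using b_disjoint[OF t] by (simp add: u_def)
  then consider "b t j i = 0" "b u j i = 0" | "b t j i = 0" "b u j i \<noteq> 0" | "b t j i \<noteq> 0" "b u j i = 0"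
    by auto
  then have "regular p (ratio2 s i j)"
  proof cases
    case 1
    obtain l :: "'c \<Rightarrow> int" where l: "additive l" "l (q t i) = l (q s i)" "l (q t j) \<noteq> l (q u j)"
      using separated[OF t ij] by (auto simp: nb_t u_def)
    define l' where "l' = (\<lambda>g :: 'c \<times> ('i \<Rightarrow> int). l (fst g))"
    have l': "additive l'"
      unfolding l'_def using l(1) by (simp add: additive_def)
    have l'_mon: "l' (mon r k - unit_vector m - unit_vector m) = l (q r k)" for r k m
      by (simp add: l'_def additive.diff[OF l(1)] additive.zero[OF l(1)])
    have p: "homogeneous l' (l (q s i)) p"
      unfolding p_def ratio_def
      by (intro homogeneous_add homogeneous_single) (simp_all add: l'_mon l(2) flip: t_def)
    show ?thesis
    proof (cases "l (q u j) < l (q t j)")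
      case True
      then have "regular p (frag_of ?g + frag_of ?h)"
        by (intro regular_frag_of_add_lower[OF l' p homogeneous_single]) (simp_all add: l'_mon)
      then show ?thesis
        by (simp add: eq 1)
    next
      case False
      with l(3) have "l (q t j) < l (q u j)"
        by linarith
      then have "regular p (frag_of ?h + frag_of ?g)"
        by (intro regular_frag_of_add_lower[OF l' p homogeneous_single]) (simp_all add: l'_mon)
      then show ?thesis
        by (simp add: eq 1 add.commute)
    qed
  next
    case 2
    then obtain n where "b u j i = Suc n"
      using not0_implies_Suc by blast
    then have "ratio2 s i j = frag_of ?g + p * (frag_of ?h * p ^ n)"
      by (simp add: eq 2 mult.left_commute)
    then show ?thesis
      by (simp add: regular_add_multiple regular_frag_of)
  next
    case 3
    then obtain n where "b t j i = Suc n"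
      using not0_implies_Suc by blast
    then have "ratio2 s i j = frag_of ?h + p * (frag_of ?g * p ^ n)"
      by (simp add: eq 3 mult.left_commute add.commute)
    then show ?thesis
      by (simp add: regular_add_multiple regular_frag_of)
  qed
  then show ?thesis
    by (simp add: p_def)
qed

text \<open>
  The quotient \<open>A\<close> is \<open>x\<^sub>i'' / x\<^sub>i\<close> after the mutations \<open>i\<close>, \<open>j\<close>, \<open>i\<close>. Modulo the ratio at
  \<open>s\<close> it is a monomial plus terms of lower degree in \<open>x\<^sub>i\<close>.
\<close>

lemma ratio_dvd_ratio3:
  assumes s: "s \<in> S" and ij: "i \<noteq> j"
  defines "u \<equiv> nb j (nb i s)"
  defines "v \<equiv> nb i u"
  shows "\<exists>A. regular (ratio s i) A \<and>
    frag_of (mon u i - unit_vector i - unit_vector i) * ratio2 s i j ^ b u i j +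
    frag_of (mon v i - unit_vector i - unit_vector i) * ratio2 s i j ^ b v i j = ratio s i * A"
proof -
  define t where "t = nb i s"
  define p where "p = ratio s i"
  define e where "e = (unit_vector i + unit_vector i :: 'c \<times> ('i \<Rightarrow> int))"
  have u: "u = nb j t"
    by (simp add: u_def t_def)
  have t: "t \<in> S" and nb_t: "nb i t = s"
    using s by (simp_all add: t_def nb_closed nb_nb)
  have uS: "u \<in> S" and vS: "v \<in> S"
    using t by (simp_all add: u v_def nb_closed)
  have p: "p = frag_of (mon s i - e) + frag_of (mon t i - e)"
    by (simp add: p_def ratio_def e_def t_def diff_diff_eq)
  have p_hom: "homogeneous (deg i) (- 2) p"
    unfolding p_def by (rule homogeneous_ratio[OF s])
  \<comment> \<open>\<open>th\<close> is the monomial without x_i that serves as \<open>h\<close> in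
    \<open>mon_exchange\<close>; \<open>r\<close> is the other one and \<open>c\<close> its exponent
    of x_i, so \<open>ratio2\<close> is \<open>th\<close> plus \<open>r\<close> times p^c.\<close>
  define th where "th = (if b t j i = 0 then mon t j else mon u j) - unit_vector j - unit_vector j"
  define r where "r = (if b t j i = 0 then mon u j else mon t j) - unit_vector j - unit_vector j"
  define c where "c = (if b t j i = 0 then b u j i else b t j i)"
  have disj: "b t j i = 0 \<or> b u j i = 0"
    using b_disjoint[OF t] by (simp add: u)
  have ratio2: "ratio2 s i j = frag_of th + frag_of r * p ^ c"
    using disj by (auto simp: ratio2_def th_def r_def c_def p_def Let_def u simp flip: t_def)
  have deg_th: "deg i th = 0" and deg_r: "deg i r = int c"
    using disj ij by (auto simp: th_def r_def c_def)
  have exch: "mon u i + mon s i + nmul (b s i j) th = mon v i + mon t i + nmul (b t i j) th"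
    using mon_exchange[OF t ij th_def[unfolded u]] by (simp add: u v_def nb_t)
  have b_eq: "b s i j = b u i j" "b t i j = b v i j"
    using b_exchange_signs[OF t ij] by (simp_all add: u v_def nb_t)
  \<comment> \<open>\<open>k\<close> is the quotient in \<open>main\<close>: with \<open>th\<close>
    in place of \<open>ratio2\<close>, the exchange relation makes the sum exactly p times one
    monomial.\<close>
  define k where "k = mon v i + nmul (b v i j) th - mon s i"
  have k_u: "mon u i - e + nmul (b u i j) th = k + (mon t i - e)"
    using exch by (simp add: k_def b_eq algebra_simps)
  have k_v: "mon v i - e + nmul (b v i j) th = k + (mon s i - e)"
    by (simp add: k_def)
  have deg_k: "deg i k = 0"
    using b_self[OF vS, of i] b_self[OF s, of i] by (simp add: k_def deg_th)
  have main: "frag_of (mon u i - e) * frag_of th ^ b u i j +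
      frag_of (mon v i - e) * frag_of th ^ b v i j = p * frag_of k"
    by (simp add: k_u k_v p distrib_left add.commute mult.commute
        flip: frag_of_nmul frag_of_add)
  let ?W = "frag_of (mon u i - e) * ratio2 s i j ^ b u i j +
      frag_of (mon v i - e) * ratio2 s i j ^ b v i j"
  have "\<exists>A. regular p A \<and> ?W = p * A"
  proof (cases "c = 0")
    case True
    \<comment> \<open>If neither monomial contains x_i, then \<open>b_exchange\<close> and
      disjointness make both exponents of \<open>ratio2\<close> zero, so replacing it by
      \<open>th\<close> changes nothing.\<close>
    then have "b t j i = 0" "b u j i = 0"
      by (auto simp: c_def split: if_splits)
    then have "b t i j = b s i j"
      using b_exchange[OF t ij] by (auto simp: u nb_t)
    then have "b t i j = 0" "b s i j = 0"
      using b_disjoint[OF t, of i j] by (auto simp: nb_t)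
    then have "?W = p * frag_of k"
      using main by (simp add: b_eq)
    then show ?thesis
      using regular_frag_of by blast
  next
    case False
    then obtain n where n: "c = Suc n"
      using not0_implies_Suc by blast
    define w where "w = frag_of r * p ^ c"
    obtain h1 where h1: "ratio2 s i j ^ b u i j = frag_of th ^ b u i j +
        of_nat (b u i j) * frag_of th ^ (b u i j - 1) * w + w\<^sup>2 * h1"
      using power_add_expand unfolding ratio2 w_def by blast
    obtain h2 where h2: "ratio2 s i j ^ b v i j = frag_of th ^ b v i j +
        of_nat (b v i j) * frag_of th ^ (b v i j - 1) * w + w\<^sup>2 * h2"
      using power_add_expand unfolding ratio2 w_def by blast
    define G where "G = frag_of r *
      (frag_of (mon u i - e) * (of_nat (b u i j) * frag_of th ^ (b u i j - 1)) +
       frag_of (mon v i - e) * (of_nat (b v i j) * frag_of th ^ (b v i j - 1)))"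
    define H where "H = (frag_of r)\<^sup>2 * p ^ n * (frag_of (mon u i - e) * h1 + frag_of (mon v i - e) * h2)"
    define A where "A = frag_of k + p ^ n * G + p ^ Suc n * H"
    have w: "w = frag_of r * (p * p ^ n)"
      by (simp add: w_def n)
    have "?W = (frag_of (mon u i - e) * frag_of th ^ b u i j +
      frag_of (mon v i - e) * frag_of th ^ b v i j) + p * (p ^ n * G + p ^ Suc n * H)"
      unfolding h1 h2 w G_def H_def power_Suc power2_eq_square
      by (simp only: distrib_left distrib_right mult_ac add_ac)
    also have "\<dots> = p * A"
      unfolding main A_def by (simp only: distrib_left add.assoc)
    finally have W: "?W = p * A" .
    have "regular p A"
    proof (cases n)
      \<comment> \<open>Only for \<open>c = 1\<close> does the linear term \<open>G\<close> survive
        modulo p. It has degree 1 - 2 = -1 in x_i, below the degree 0 of \<open>k\<close>.\<close>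
      case 0
      have of_nat_hom: "homogeneous (deg i) 0 (of_nat d :: ('c \<times> ('i \<Rightarrow> int)) \<Rightarrow>\<^sub>0 int)" for d
        using homogeneous_single[of "deg i" "0 :: 'c \<times> ('i \<Rightarrow> int)" 0 "int d"] by simp
      have th_hom: "homogeneous (deg i) 0 (frag_of th ^ d)" for d
        using homogeneous_power[OF additive_deg homogeneous_single[of "deg i", OF deg_th]] by simp
      have mon_hom: "homogeneous (deg i) (- 2) (frag_of (mon x i - e))" if "x \<in> S" for x
        using b_self[OF that] by (intro homogeneous_single) (simp add: e_def)
      have "homogeneous (deg i) (1 + ((- 2) + (0 + 0))) G"
        unfolding G_def using 0 n
        by (intro homogeneous_mult homogeneous_add additive_deg homogeneous_single mon_hom
            of_nat_hom th_hom uS vS) (simp add: deg_r)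
      then have "regular p (frag_of k + G)"
        by (rule regular_frag_of_add_lower[OF additive_deg p_hom]) (simp add: deg_k)
      then show ?thesis
        by (simp add: A_def 0 regular_add_multiple)
    next
      case (Suc m)
      have "A = frag_of k + p * (p ^ m * G + p ^ n * H)"
        by (simp add: A_def Suc distrib_left mult.assoc add.assoc)
      then show ?thesis
        by (simp add: regular_add_multiple regular_frag_of)
    qed
    with W show ?thesis
      by blast
  qed
  then show ?thesis
    by (simp add: p_def e_def diff_diff_eq)
qed

end

section \<open>Mutation of characters and the Laurent phenomenon\<close>

context mutation_pattern
begin

text \<open>Rescaling x_i by P/x_i^2 turns it into P/x_i, the exchanged variable.\<close>

definition mutate :: "'s \<Rightarrow> 'i \<Rightarrow> ('c \<times> ('i \<Rightarrow> int) \<Rightarrow> 'f::field) \<Rightarrow> 'c \<times> ('i \<Rightarrow> int) \<Rightarrow> 'f" where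
  "mutate s i \<chi> = twist \<chi> (ev \<chi> (ratio s i)) (deg i)"

fun run :: "'i list \<Rightarrow> 's \<Rightarrow> ('c \<times> ('i \<Rightarrow> int) \<Rightarrow> 'f::field) \<Rightarrow> 'c \<times> ('i \<Rightarrow> int) \<Rightarrow> 'f" where
  "run [] s \<chi> = \<chi>"
| "run (i # w) s \<chi> = run w (nb i s) (mutate s i \<chi>)"

lemma ev_ratio_nonzero: "free_character \<chi> \<Longrightarrow> ev \<chi> (ratio s i) \<noteq> 0"
  by (simp add: free_character_ev_eq_0_iff ratio_nonzero)

lemma free_character_mutate: "s \<in> S \<Longrightarrow> free_character \<chi> \<Longrightarrow> free_character (mutate s i \<chi>)"
  unfolding mutate_def
  by (intro free_character_twist additive_deg homogeneous_ratio ratio_nonzero)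

lemma mutate_mutate:
  assumes "s \<in> S" "free_character \<chi>"
  shows "mutate (nb i s) i (mutate s i \<chi>) = \<chi>"
proof -
  let ?r = "ev \<chi> (ratio s i)"
  \<comment> \<open>The ratio is homogeneous of degree -2 in x_i, so its new value r^(-2) r = r^(-1)
    undoes the scaling.\<close>
  have "ev (mutate s i \<chi>) (ratio s i) = ?r powi (- 2) * ?r"
    unfolding mutate_def by (rule ev_twist_homogeneous[OF homogeneous_ratio[OF assms(1)]])
  also have "\<dots> = inverse ?r"
    using ev_ratio_nonzero[OF assms(2)] by (simp add: power_int_minus power2_eq_square)
  finally show ?thesis
    using ev_ratio_nonzero[OF assms(2), of s i] assms(1)
    by (simp add: mutate_def[of "nb i s"] ratio_nb) (simp add: mutate_def twist_twist_inverse)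
qed

lemma laurent_intersection:
  fixes \<chi> :: "'c \<times> ('i \<Rightarrow> int) \<Rightarrow> 'f::field"
  assumes s: "s \<in> S" and ij: "i \<noteq> j" and \<chi>: "free_character \<chi>"
  defines "\<chi>1 \<equiv> mutate s i \<chi>"
  defines "\<chi>2 \<equiv> mutate (nb i s) j \<chi>1"
  defines "\<chi>3 \<equiv> mutate (nb j (nb i s)) i \<chi>2"
  assumes z1: "z \<in> range (ev \<chi>1)" and z3: "z \<in> range (ev \<chi>3)"
  shows "z \<in> range (ev \<chi>)"
proof -
  define t where "t = nb i s"
  define u where "u = nb j t"
  define v where "v = nb i u"
  define p where "p = ratio s i"
  define B where "B = ratio2 s i j"
  have t: "t \<in> S" and u: "u \<in> S" and v: "v \<in> S"
    using s by (simp_all add: t_def u_def v_def nb_closed)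
  note char = free_characterD[OF \<chi>]
  have p_nz: "ev \<chi> p \<noteq> 0"
    unfolding p_def by (rule ev_ratio_nonzero[OF \<chi>])
  have \<chi>1: "\<chi>1 = twist \<chi> (ev \<chi> p) (deg i)"
    by (simp add: \<chi>1_def mutate_def p_def)
  have free1: "free_character \<chi>1" and free2: "free_character \<chi>2"
    unfolding \<chi>2_def \<chi>1_def using s \<chi> by (simp_all add: free_character_mutate nb_closed)
  \<comment> \<open>Every x_i in the exchange ratio at j now carries a factor p;
    \<open>ratio2\<close> is the outcome.\<close>
  have B: "ev \<chi>1 (ratio t j) = ev \<chi> B"
    using ij unfolding ratio_def \<chi>1
    by (simp add: B_def ratio2_def Let_def ev_add ev_mult[OF char] ev_power[OF char] twist_def
        p_def flip: t_def u_def)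
  have B_nz: "ev \<chi> B \<noteq> 0"
    unfolding B[symmetric] by (rule ev_ratio_nonzero[OF free1])
  have \<chi>2: "\<chi>2 = twist \<chi>1 (ev \<chi> B) (deg j)"
    by (simp add: \<chi>2_def mutate_def B flip: t_def)
  obtain A where A: "regular p A" and W: "frag_of (mon u i - unit_vector i - unit_vector i) * B ^ b u i j +
      frag_of (mon v i - unit_vector i - unit_vector i) * B ^ b v i j = p * A"
    using ratio_dvd_ratio3[OF s ij] unfolding p_def B_def u_def v_def t_def by blast
  \<comment> \<open>The first mutation of x_i contributes p^(-2) to the sum in \<open>W\<close>, so
    the second scaling factor of x_i is A/p.\<close>
  have "ev \<chi>2 (ratio u i) = ev \<chi> p powi (- 2) * ev \<chi> (p * A)"
    using ij b_self[OF u] b_self[OF v] unfolding W[symmetric]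
    by (simp add: ratio_def \<chi>2 \<chi>1 ev_add ev_mult[OF char] ev_power[OF char] twist_def
        distrib_left mult_ac flip: v_def)
  then have A_eq: "ev \<chi> p * ev \<chi>2 (ratio u i) = ev \<chi> A"
    using p_nz by (simp add: ev_mult[OF char] power_int_minus power2_eq_square field_simps)
  have A_nz: "ev \<chi> A \<noteq> 0"
    unfolding A_eq[symmetric] using p_nz ev_ratio_nonzero[OF free2] by simp
  \<comment> \<open>The scaling factors p and A/p of x_i multiply to A, so p no longer occurs in the
    denominators coming from \<open>\<chi>3\<close>.\<close>
  have \<chi>3: "\<chi>3 = twist (twist \<chi> (ev \<chi> A) (deg i)) (ev \<chi> B) (deg j)"
    unfolding \<chi>3_def mutate_def A_eq[symmetric]
    by (simp add: \<chi>2 \<chi>1 twist_def fun_eq_iff power_int_mult_distrib mult_ac flip: t_def u_def)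
  obtain m a where a: "ev \<chi> p ^ m * z = ev \<chi> a"
  proof -
    obtain f where f: "z = ev \<chi>1 f"
      using z1 by blast
    obtain m where "\<forall>g\<in>Poly_Mapping.keys f. - deg i g \<le> int m"
      using finite_bound[of "Poly_Mapping.keys f" "deg i"] by auto
    then show ?thesis
      using that ev_twist_clear_denominator[OF char p_nz, of f "deg i" m] unfolding f \<chi>1 by blast
  qed
  obtain m' n c where c: "ev \<chi> A ^ m' * ev \<chi> B ^ n * z = ev \<chi> c"
    using z3 ev_twist_twist_clear_denominators[OF char A_nz B_nz] unfolding \<chi>3 by blast
  \<comment> \<open>Equate the two fractions a/p^m = z = c/(A^m' B^n); by freeness the result holds
    in the group ring.\<close>
  have "ev \<chi> (a * B ^ n * A ^ m') = ev \<chi> (p ^ m * c)"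
    by (simp add: ev_mult[OF char] ev_power[OF char] mult_ac flip: a c)
  then have "a * B ^ n * A ^ m' = p ^ m * c"
    by (simp add: free_character_ev_inject[OF \<chi>])
  then have "p ^ m dvd a * B ^ n * A ^ m'"
    by simp
  moreover have cancel: "x = y" if "p * x = p * y" for x y
  proof -
    have "ev \<chi> p * ev \<chi> x = ev \<chi> p * ev \<chi> y"
      using that by (simp flip: ev_mult[OF char])
    then show ?thesis
      using p_nz by (simp add: free_character_ev_inject[OF \<chi>])
  qed
  moreover have "regular p B"
    unfolding p_def B_def by (rule regular_ratio2[OF s ij])
  ultimately have "p ^ m dvd a"
    using power_dvd_cancel_regular[OF regular_power cancel] A by blast
  then obtain a' where "a = p ^ m * a'"
    by (rule dvdE)
  then have "z = ev \<chi> a'"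
    using a p_nz by (simp add: ev_mult[OF char] ev_power[OF char])
  then show ?thesis
    by blast
qed

theorem laurent_phenomenon:
  assumes "s \<in> S" "free_character \<chi>"
  shows "run w s \<chi> (unit_vector k) \<in> range (ev \<chi>)"
  using assms
proof (induction "length w" arbitrary: w s \<chi> rule: less_induct)
  case less
  note s = less.prems(1) and \<chi> = less.prems(2)
  note char = free_characterD[OF \<chi>]
  consider "w = []" | i where "w = [i]" | i w' where "w = i # i # w'" | i j w' where "w = i # j # w'" "i \<noteq> j"
    by (metis list.exhaust)
  then show ?case
  proof cases
    case 1
    have "\<chi> (unit_vector k) = ev \<chi> (frag_of (unit_vector k))"
      by simp
    then show ?thesis
      unfolding 1 by (simp only: run.simps rangeI)
  next
    case (2 i)
    have "run w s \<chi> (unit_vector k) =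
      ev \<chi> (frag_of (unit_vector k) * (if k = i then ratio s i else 1))"
      by (simp add: 2 mutate_def twist_def ev_mult[OF char] ev_one[OF char])
    then show ?thesis
      by (simp only: rangeI)
  next
    case (3 i w')
    then show ?thesis
      using less.hyps[of w' s \<chi>] s \<chi> by (simp add: nb_nb mutate_mutate)
  next
    case (4 i j w')
    let ?t = "nb i s" and ?u = "nb j (nb i s)"
    let ?\<chi>1 = "mutate s i \<chi>"
    let ?\<chi>2 = "mutate ?t j ?\<chi>1"
    have S: "?t \<in> S" "?u \<in> S" "nb i ?u \<in> S"
      using s by (simp_all add: nb_closed)
    have free: "free_character ?\<chi>1" "free_character ?\<chi>2" "free_character (mutate ?u i ?\<chi>2)"
      using s S \<chi> by (simp_all add: free_character_mutate)
    \<comment> \<open>Inserting \<open>i\<close>, \<open>i\<close> after \<open>i\<close>,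
      \<open>j\<close> changes nothing, and from the cluster reached by \<open>i\<close>,
      \<open>j\<close>, \<open>i\<close> the remaining walk \<open>i # w'\<close> is shorter than
      \<open>w\<close>.\<close>
    have "run w s \<chi> = run (i # w') (nb i ?u) (mutate ?u i ?\<chi>2)"
      using S free by (simp add: 4 nb_nb mutate_mutate)
    then have "run w s \<chi> (unit_vector k) \<in> range (ev (mutate ?u i ?\<chi>2))"
      using less.hyps[OF _ S(3) free(3), of "i # w'"] 4 by simp
    moreover have "run w s \<chi> (unit_vector k) \<in> range (ev ?\<chi>1)"
      using less.hyps[OF _ S(1) free(1), of "j # w'"] 4 by simp
    ultimately show ?thesis
      using laurent_intersection[OF s 4(2) \<chi>] by blast
  qed
qed

end

section \<open>Characters of rational function fields\<close>

lemma character_sum: "character \<chi> \<Longrightarrow> \<chi> (sum f A) = (\<Prod>a\<in>A. \<chi> (f a))"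
  by (induction A rule: infinite_finite_induct) (simp_all add: character_zero character_add)

lemma sum_fun_apply: "sum f A x = (\<Sum>a\<in>A. f a x)"
  by (induction A rule: infinite_finite_induct) simp_all

lemma exponent_vector_decompose:
  fixes c :: "'c::comm_monoid_add" and n :: "'i \<Rightarrow> nat"
  assumes "finite (UNIV :: 'i set)"
  shows "exponent_vector c n = (c, 0) + (\<Sum>k\<in>UNIV. nmul (n k) (unit_vector k))"
proof (rule prod_eqI)
  have "(\<Sum>k\<in>UNIV. int (n k) * (if j = k then 1 else 0)) = int (n j)" for j
    using assms by (simp add: if_distrib cong: if_cong)
  then have "(\<Sum>k\<in>UNIV. nmul (n k) (snd (unit_vector k :: 'c \<times> ('i \<Rightarrow> int)))) = (\<lambda>k. int (n k))"
    by (auto simp: sum_fun_apply unit_vector_def)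
  then show "snd (exponent_vector c n) = snd ((c, 0) + (\<Sum>k\<in>UNIV. nmul (n k) (unit_vector k)))"
    by (simp add: exponent_vector_def snd_sum)
  have "nmul m (0 :: 'c) = 0" for m
    by (induction m) simp_all
  then show "fst (exponent_vector c n) = fst ((c, 0) + (\<Sum>k\<in>UNIV. nmul (n k) (unit_vector k)))"
    by (simp add: exponent_vector_def fst_sum)
qed

lemma character_exponent_vector:
  fixes n :: "'i \<Rightarrow> nat"
  assumes "character \<chi>" "finite (UNIV :: 'i set)"
  shows "\<chi> (exponent_vector c n) = \<chi> (c, 0) * (\<Prod>k\<in>UNIV. \<chi> (unit_vector k) ^ n k)"
  unfolding exponent_vector_decompose[OF assms(2)]
  by (simp add: character_add[OF assms(1)] character_sum[OF assms(1)] character_nmul[OF assms(1)])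

lemma ring_morphism_add: "ring_morphism f \<Longrightarrow> f (a + b) = f a + f b"
  and ring_morphism_mult: "ring_morphism f \<Longrightarrow> f (a * b) = f a * f b"
  and ring_morphism_one: "ring_morphism f \<Longrightarrow> f 1 = 1"
  by (simp_all add: ring_morphism_def)

lemma ring_morphism_zero: "ring_morphism f \<Longrightarrow> f 0 = 0"
  using ring_morphism_add[of f 0 0] by simp

lemma ring_morphism_uminus: "ring_morphism f \<Longrightarrow> f (- a) = - f a"
  by (metis add.right_inverse eq_neg_iff_add_eq_0 add.commute ring_morphism_add ring_morphism_zero)

lemma ring_morphism_of_nat: "ring_morphism f \<Longrightarrow> f (of_nat n) = of_nat n"
  by (induction n) (simp_all add: ring_morphism_zero ring_morphism_one ring_morphism_add)

lemma ring_morphism_of_int: "ring_morphism f \<Longrightarrow> f (of_int n) = of_int n"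
  by (cases n) (simp_all add: ring_morphism_uminus ring_morphism_of_nat del: of_nat_Suc)

lemma ring_morphism_power: "ring_morphism f \<Longrightarrow> f (a ^ n) = f a ^ n"
  by (induction n) (simp_all add: ring_morphism_one ring_morphism_mult)

lemma ring_morphism_prod: "ring_morphism f \<Longrightarrow> f (prod g A) = (\<Prod>a\<in>A. f (g a))" for g :: "'i \<Rightarrow> 'a::comm_ring_1"
    and f :: "'a \<Rightarrow> 'b::comm_ring_1"
  by (induction A rule: infinite_finite_induct) (simp_all add: ring_morphism_one ring_morphism_mult)

lemma single_of_int_mult:
  fixes a :: "'a::comm_ring_1"
  shows "of_int n * Poly_Mapping.single e a = Poly_Mapping.single e (of_int n * a)"
proof -
  have "of_int n * Poly_Mapping.single e a = Poly_Mapping.single (0 + e) (of_int n * a)"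
    unfolding mult_single[symmetric] by simp
  then show ?thesis
    by simp
qed

section \<open>Laurent monomials evaluated at a tuple of field elements\<close>

definition laurent_character ::
  "('p::ab_group_add group_ring \<Rightarrow> 'f::field) \<Rightarrow> ('i::finite \<Rightarrow> 'f) \<Rightarrow> 'p \<times> ('i \<Rightarrow> int) \<Rightarrow> 'f"
  where "laurent_character \<iota> y g = \<iota> (frag_of (fst g)) * (\<Prod>i\<in>UNIV. y i powi snd g i)"

lemma character_laurent_character:
  assumes "ring_morphism \<iota>" "\<And>i. y i \<noteq> 0"
  shows "character (laurent_character \<iota> y)"
  using assms
  by (simp add: character_def laurent_character_def frag_of_add ring_morphism_one ring_morphism_mult
      power_int_add prod.distrib mult_ac)

lemma monomial_at_eq_laurent_character:
  "monomial_at \<iota> y M = laurent_character \<iota> y (exponent_vector (fst M) (Poly_Mapping.lookup (snd M)))"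
  by (simp add: monomial_at_def power_product_def laurent_character_def exponent_vector_def)

lemma laurent_character_mem_laurent_ring:
  assumes "ring_morphism \<kappa>" "\<And>g. \<chi> g \<in> range (laurent_character \<kappa> y)"
  shows "ev \<chi> f \<in> laurent_ring \<kappa> y"
proof -
  have "ev \<chi> f \<in> T"
    if T: "unital_subring T" "range \<kappa> \<union> range y \<union> range (\<lambda>i. inverse (y i)) \<subseteq> T" for T
  proof -
    have plus: "a + b \<in> T" and times: "a * b \<in> T" if "a \<in> T" "b \<in> T" for a b
      using T(1) that by (simp_all add: unital_subring_def)
    have T01: "0 \<in> T" "1 \<in> T"
      using T(1) by (simp_all add: unital_subring_def)
    have power: "a ^ n \<in> T" if "a \<in> T" for a n
      using that by (induction n) (simp_all add: T01 times)
    have "y i powi n \<in> T" for i n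
      using T(2) by (auto simp: power_int_def intro!: power)
    then have "(\<Prod>i\<in>A. y i powi g i) \<in> T" for A and g :: "_ \<Rightarrow> int"
      by (induction A rule: infinite_finite_induct) (simp_all add: T01 times)
    then have "\<chi> g \<in> T" for g
      using assms(2)[of g] T(2) by (force simp: laurent_character_def intro: times)
    moreover have "of_int n = \<kappa> (of_int n)" for n
      by (simp add: ring_morphism_of_int assms(1))
    then have "of_int n \<in> T" for n
      using T(2) by (metis UnCI rangeI subsetD)
    ultimately have "of_int (Poly_Mapping.lookup f g) * \<chi> g \<in> T" for g
      by (intro times)
    then have "(\<Sum>g\<in>A. of_int (Poly_Mapping.lookup f g) * \<chi> g) \<in> T" for A
      by (induction A rule: infinite_finite_induct) (simp_all add: T01 plus)
    then show ?thesis
      by (simp add: ev_def)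
  qed
  then show ?thesis
    unfolding laurent_ring_def hull_def by blast
qed

context rational_function_field
begin

lemma poly_at_superset:
  assumes "finite A" "Poly_Mapping.keys Q \<subseteq> A"
  shows "poly_at \<iota> X Q = (\<Sum>b\<in>A. \<iota> (Poly_Mapping.lookup Q b) * power_product X b)"
  unfolding poly_at_def using assms
  by (intro sum.mono_neutral_left)
    (auto simp: not_in_keys_iff_lookup_eq_zero ring_morphism_zero[OF coefficient_embedding])

lemma poly_at_add: "poly_at \<iota> X (P + Q) = poly_at \<iota> X P + poly_at \<iota> X Q"
proof -
  let ?A = "Poly_Mapping.keys P \<union> Poly_Mapping.keys Q"
  have "poly_at \<iota> X (P + Q) = (\<Sum>b\<in>?A. \<iota> (Poly_Mapping.lookup (P + Q) b) * power_product X b)"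
    by (rule poly_at_superset) (simp_all add: keys_add)
  also have "\<dots> = poly_at \<iota> X P + poly_at \<iota> X Q"
    by (simp add: poly_at_superset[of ?A] lookup_add ring_morphism_add[OF coefficient_embedding]
        distrib_right sum.distrib)
  finally show ?thesis .
qed

lemma poly_at_zero [simp]: "poly_at \<iota> X 0 = 0"
  by (simp add: poly_at_def)

lemma poly_at_sum: "poly_at \<iota> X (sum Q A) = (\<Sum>a\<in>A. poly_at \<iota> X (Q a))"
  by (induction A rule: infinite_finite_induct) (simp_all add: poly_at_add)

lemma poly_at_single [simp]: "poly_at \<iota> X (Poly_Mapping.single b c) = \<iota> c * power_product X b"
  by (simp add: poly_at_def ring_morphism_zero[OF coefficient_embedding])

lemma poly_at_eq_0_iff: "poly_at \<iota> X Q = 0 \<longleftrightarrow> Q = 0"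
  using inj_eq[OF free, of Q 0] by simp

lemma variable_nonzero: "X i \<noteq> 0"
proof
  assume "X i = 0"
  let ?e = "Poly_Mapping.single i (1 :: nat)"
  have "power_product X ?e = 0"
    unfolding power_product_def using \<open>X i = 0\<close> by (intro prod_zero[OF _ bexI[of _ i]]) simp_all
  then have "poly_at \<iota> X (Poly_Mapping.single ?e 1) = 0"
    by simp
  then have "Poly_Mapping.lookup (Poly_Mapping.single ?e (1 :: 'p group_ring)) ?e = 0"
    by (simp only: poly_at_eq_0_iff lookup_zero)
  then show False
    by simp
qed

text \<open>Multiplying by a high power of the product of the variables turns a Laurent polynomial into a polynomial.\<close>

lemma free_laurent_character: "free_character (laurent_character \<iota> X)"
proof (rule free_characterI)
  show "character (laurent_character \<iota> X)"
    by (rule character_laurent_character[OF coefficient_embedding variable_nonzero])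
  fix T :: "('p \<times> ('i \<Rightarrow> int)) set" and c
  assume T: "finite T" and sum0: "(\<Sum>g\<in>T. of_int (c g) * laurent_character \<iota> X g) = 0"
  \<comment> \<open>The least exponent over all variables is used so that one \<open>m\<close>
    serves for every variable.\<close>
  have "\<exists>m. \<forall>g\<in>T. - Min (range (snd g)) \<le> int m"
    using finite_bound[OF T] .
  then obtain m where m: "\<forall>g\<in>T. - Min (range (snd g)) \<le> int m"
    by blast
  have m': "- snd g i \<le> int m" if "g \<in> T" for g i
  proof -
    have "Min (range (snd g)) \<le> snd g i"
      by simp
    moreover have "- Min (range (snd g)) \<le> int m"
      using m that by blast
    ultimately show ?thesis
      by linarith
  qed
  define e where "e = (\<lambda>g :: 'p \<times> ('i \<Rightarrow> int). Abs_poly_mapping (\<lambda>i. nat (snd g i + int m)))"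
  have lookup_e: "Poly_Mapping.lookup (e g) i = nat (snd g i + int m)" for g i
    by (simp add: e_def)
  define Q where "Q = (\<Sum>g\<in>T. Poly_Mapping.single (e g) (Poly_Mapping.single (fst g) (c g)))"
  have coeff: "\<iota> (Poly_Mapping.single a n) = of_int n * \<iota> (frag_of a)" for a n
  proof -
    have "Poly_Mapping.single a n = of_int n * frag_of a"
      by (simp add: single_of_int_mult)
    then show ?thesis
      by (simp only: ring_morphism_mult[OF coefficient_embedding] ring_morphism_of_int[OF coefficient_embedding])
  qed
  have "poly_at \<iota> X Q = (\<Sum>g\<in>T. of_int (c g) * laurent_character \<iota> X g * (\<Prod>i\<in>UNIV. X i ^ m))"
    unfolding Q_def poly_at_sum
  proof (intro sum.cong refl)
    fix g
    assume "g \<in> T"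
    have "X i ^ nat (snd g i + int m) = X i powi snd g i * X i ^ m" for i
      unfolding power_mult_power_int[OF variable_nonzero m'[OF \<open>g \<in> T\<close>], symmetric]
      by (rule mult.commute)
    then have "power_product X (e g) = (\<Prod>i\<in>UNIV. X i powi snd g i) * (\<Prod>i\<in>UNIV. X i ^ m)"
      by (simp add: power_product_def lookup_e flip: prod.distrib)
    then show "poly_at \<iota> X (Poly_Mapping.single (e g) (Poly_Mapping.single (fst g) (c g))) =
        of_int (c g) * laurent_character \<iota> X g * (\<Prod>i\<in>UNIV. X i ^ m)"
      by (simp add: coeff[of "fst g" "c g"] laurent_character_def mult_ac)
  qed
  also have "\<dots> = 0"
    using sum0 by (simp flip: sum_distrib_right)
  finally have "Q = 0"
    by (simp add: poly_at_eq_0_iff)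
  show "\<forall>g\<in>T. c g = 0"
  proof
    fix h
    assume "h \<in> T"
    \<comment> \<open>Distinct \<open>g\<close> contribute to distinct coefficients of
      \<open>Q\<close>: the shifted exponents are nonnegative, so \<open>nat\<close> loses
      nothing.\<close>
    have inj: "e g = e h \<and> fst g = fst h \<longleftrightarrow> g = h" if "g \<in> T" for g
    proof
      assume eq: "e g = e h \<and> fst g = fst h"
      have "snd g i = snd h i" for i
      proof -
        have "nat (snd g i + int m) = nat (snd h i + int m)"
          using eq by (simp flip: lookup_e)
        then show ?thesis
          using m'[OF that, of i] m'[OF \<open>h \<in> T\<close>, of i] by linarith
      qed
      with eq show "g = h"
        by (auto simp: prod_eq_iff)
    qed simp
    have "0 = Poly_Mapping.lookup (Poly_Mapping.lookup Q (e h)) (fst h)"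
      by (simp add: \<open>Q = 0\<close>)
    also have "\<dots> = (\<Sum>g\<in>T. if g = h then c g else 0)"
      unfolding Q_def lookup_sum using inj
      by (intro sum.cong refl) (auto simp: lookup_single when_def)
    also have "\<dots> = c h"
      using T \<open>h \<in> T\<close> by simp
    finally show "c h = 0"
      by simp
  qed
qed

end

section \<open>Adjoining generic coefficients\<close>

text \<open>Generic coefficients live in the group ring of \<open>'e\<close> over \<open>'f\<close>.
  The linear order on \<open>'e\<close> excludes zero divisors there, so its fraction field can
  serve as the target.\<close>

definition extended_character ::
  "('c \<times> ('i \<Rightarrow> int) \<Rightarrow> 'f::field) \<Rightarrow> ('c \<times> 'e) \<times> ('i \<Rightarrow> int) \<Rightarrow>
    ('e::linordered_ab_group_add \<Rightarrow>\<^sub>0 'f) fract"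
  where "extended_character \<chi> g = Fract (Poly_Mapping.single (snd (fst g)) (\<chi> (fst (fst g), snd g))) 1"

lemma of_int_fract: "of_int n = Fract (of_int n) 1"
  by (cases n) (simp_all add: Fract_of_nat_eq One_fract_def Zero_fract_def del: of_nat_Suc flip: minus_fract)

lemma sum_fract: "(\<Sum>a\<in>A. Fract (f a) 1) = Fract (sum f A) 1"
  by (induction A rule: infinite_finite_induct) (simp_all add: Zero_fract_def)

lemma character_extended_character:
  fixes \<chi> :: "'c::ab_group_add \<times> ('i \<Rightarrow> int) \<Rightarrow> 'f::field"
  assumes "character \<chi>"
  shows "character (extended_character \<chi> :: ('c \<times> 'e::linordered_ab_group_add) \<times> ('i \<Rightarrow> int) \<Rightarrow> _)"
proof -
  have "\<chi> (0, 0) = 1" "\<chi> (a + a', d + d') = \<chi> (a, d) * \<chi> (a', d')" for a a' d d'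
    using assms unfolding character_def zero_prod_def by (simp_all flip: add_Pair)
  then show ?thesis
    by (simp add: character_def extended_character_def mult_single One_fract_def)
qed

lemma free_extended_character:
  fixes \<chi> :: "'c::ab_group_add \<times> ('i \<Rightarrow> int) \<Rightarrow> 'f::field"
  assumes \<chi>: "free_character \<chi>"
  shows "free_character (extended_character \<chi> :: ('c \<times> 'e::linordered_ab_group_add) \<times> ('i \<Rightarrow> int) \<Rightarrow> _)"
proof (rule free_characterI)
  show "character (extended_character \<chi> :: ('c \<times> 'e) \<times> ('i \<Rightarrow> int) \<Rightarrow> _)"
    by (rule character_extended_character[OF free_characterD[OF \<chi>]])
  fix T :: "(('c \<times> 'e) \<times> ('i \<Rightarrow> int)) set" and c
  assume T: "finite T" and sum0: "(\<Sum>g\<in>T. of_int (c g) * extended_character \<chi> g) = 0"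
  define f where "f g = Poly_Mapping.single (snd (fst g)) (of_int (c g) * \<chi> (fst (fst g), snd g))" for g
  have "(\<Sum>g\<in>T. of_int (c g) * extended_character \<chi> g) = (\<Sum>g\<in>T. Fract (f g) 1)"
    by (simp add: extended_character_def of_int_fract f_def single_of_int_mult)
  then have "Fract (sum f T) 1 = 0"
    using sum0 by (simp add: sum_fract)
  then have "sum f T = 0"
    by (simp add: Zero_fract_def eq_fract)
  show "\<forall>g\<in>T. c g = 0"
  proof
    fix h
    assume h: "h \<in> T"
    define e where "e = snd (fst h)"
    \<comment> \<open>On the terms with generic exponent \<open>e\<close>, the map \<open>?r\<close>
      forgets this exponent and \<open>?s\<close> restores it, so the coefficient at
      \<open>e\<close> is a relation between values of \<chi> alone.\<close>
    let ?T = "{g \<in> T. snd (fst g) = e}"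
    let ?r = "\<lambda>g :: ('c \<times> 'e) \<times> ('i \<Rightarrow> int). (fst (fst g), snd g)"
    let ?s = "\<lambda>g :: 'c \<times> ('i \<Rightarrow> int). ((fst g, e), snd g)"
    have inj: "inj_on ?r ?T"
      by (rule inj_onI) (simp add: prod_eq_iff)
    have "0 = Poly_Mapping.lookup (sum f T) e"
      by (simp add: \<open>sum f T = 0\<close>)
    also have "\<dots> = (\<Sum>g\<in>T. if snd (fst g) = e then of_int (c g) * \<chi> (?r g) else 0)"
      unfolding lookup_sum by (intro sum.cong refl) (auto simp: f_def lookup_single when_def)
    also have "\<dots> = (\<Sum>g\<in>?T. of_int (c g) * \<chi> (?r g))"
      using T by (simp add: sum.inter_filter)
    also have "\<dots> = (\<Sum>g\<in>?T. of_int (c (?s (?r g))) * \<chi> (?r g))"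
      by (intro sum.cong refl) (auto simp: prod_eq_iff intro!: arg_cong[where f = c])
    also have "\<dots> = (\<Sum>g\<in>?r ` ?T. of_int (c (?s g)) * \<chi> g)"
      using sum.reindex[OF inj, of "\<lambda>g. of_int (c (?s g)) * \<chi> g"] by (simp add: comp_def)
    finally have "(\<Sum>g\<in>?r ` ?T. of_int (c (?s g)) * \<chi> g) = 0"
      by simp
    moreover have "?r h \<in> ?r ` ?T"
      using h by (intro imageI) (simp add: e_def)
    ultimately have "c (?s (?r h)) = 0"
      using free_character_independent[OF \<chi>, of "?r ` ?T" "\<lambda>g. c (?s g)" "?r h"] T by simp
    then show "c h = 0"
      by (simp add: e_def)
  qed
qed

lemma max_minus_max: "max x 0 - max (- x) 0 = x" for x :: "'e::linordered_ab_group_add"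
  using linear[of x 0] by (auto simp: max_def)

lemma nmul_Pair: "nmul n (a, c) = (nmul n a, nmul n c)"
  by (simp add: prod_eq_iff)

text \<open>
  A coefficient of the deformed pattern is \<open>max (v i) 0\<close>, where \<open>v i\<close> is the difference of the
  exponents of the two coefficients on the edge labelled \<open>i\<close>. It is determined by \<open>v i\<close> up to
  sign, whence mutation acts on \<open>v\<close> by unimodular transformations.
\<close>

context monomial_pattern
begin

text \<open>The generic exponent of the monomial \<open>h\<close> in \<open>mon_exchange\<close>;
  \<open>v j\<close> changes sign across the edge j, hence the second alternative.\<close>

definition shift :: "'s \<Rightarrow> 'i \<Rightarrow> ('i \<Rightarrow> 'e::linordered_ab_group_add) \<Rightarrow> 'i \<Rightarrow> 'e" where
  "shift t j v i = (if b t j i = 0 then max (v j) 0 else max (- v j) 0)"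

text \<open>The new value at \<open>i\<close> is forced: it is the generic part of
  \<open>mon_exchange\<close>, solved for the new difference of exponents.\<close>

definition deformed_nb :: "'i \<Rightarrow> 's \<times> ('i \<Rightarrow> 'e::linordered_ab_group_add) \<Rightarrow> 's \<times> ('i \<Rightarrow> 'e)" where
  "deformed_nb j s = (nb j (fst s), \<lambda>i. if i = j then - snd s j
     else snd s i + nmul (b (fst s) i j) (shift (fst s) j (snd s) i)
       - nmul (b (nb i (fst s)) i j) (shift (fst s) j (snd s) i))"

definition deformed_q :: "'s \<times> ('i \<Rightarrow> 'e::linordered_ab_group_add) \<Rightarrow> 'i \<Rightarrow> 'c \<times> 'e" where
  "deformed_q s i = (q (fst s) i, max (snd s i) 0)"

definition deformed_b :: "'s \<times> ('i \<Rightarrow> 'e::linordered_ab_group_add) \<Rightarrow> 'i \<Rightarrow> 'i \<Rightarrow> nat" where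
  "deformed_b s = b (fst s)"

definition deformed_mon :: "'s \<times> ('i \<Rightarrow> 'e::linordered_ab_group_add) \<Rightarrow> 'i \<Rightarrow> ('c \<times> 'e) \<times> ('i \<Rightarrow> int)" where
  "deformed_mon s i = exponent_vector (deformed_q s i) (deformed_b s i)"

text \<open>Dual integral functionals express the independence of the \<open>v i\<close> in a form
  that survives mutation and yields the gradings for \<open>separated\<close>.\<close>

definition dual_states :: "('s \<times> ('i \<Rightarrow> 'e::linordered_ab_group_add)) set" where
  "dual_states = {(t, v). t \<in> S \<and>
     (\<exists>l :: 'i \<Rightarrow> 'e \<Rightarrow> int. \<forall>k. additive (l k) \<and> (\<forall>i. l k (v i) = (if k = i then 1 else 0)))}"

lemma fst_deformed_nb [simp]: "fst (deformed_nb j s) = nb j (fst s)"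
  by (simp add: deformed_nb_def)

lemma snd_deformed_nb_self [simp]: "snd (deformed_nb j s) j = - snd s j"
  by (simp add: deformed_nb_def)

text \<open>Mutation at j interchanges the two exponents of x_j and, when they differ, keeps
  \<open>shift\<close>, so the second correction cancels the first. Equal exponents give no
  correction.\<close>

lemma deformed_nb_deformed_nb:
  assumes "fst s \<in> S"
  shows "deformed_nb j (deformed_nb j s) = s"
proof (rule prod_eqI)
  show "fst (deformed_nb j (deformed_nb j s)) = fst s"
    using assms by (simp add: nb_nb)
  show "snd (deformed_nb j (deformed_nb j s)) = snd s"
  proof
    fix i
    let ?t = "fst s" and ?v = "snd s"
    let ?s' = "deformed_nb j s"
    show "snd (deformed_nb j ?s') i = snd s i"
    proof (cases "i = j")
      case False
      have signs: "b (nb j ?t) i j = b (nb i ?t) i j" "b (nb i (nb j ?t)) i j = b ?t i j"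
        using b_exchange_signs[OF assms False] by simp_all
      show ?thesis
      proof (cases "b ?t i j = b (nb i ?t) i j")
        case True
        then show ?thesis
          using False signs by (simp add: deformed_nb_def)
      next
        case neq: False
        have "b ?t j i = 0 \<longleftrightarrow> b (nb j ?t) j i \<noteq> 0"
          using b_exchange[OF assms False neq] b_disjoint[OF assms, of j i] by auto
        then have "shift (nb j ?t) j (snd ?s') i = shift ?t j ?v i"
          by (simp add: shift_def)
        then show ?thesis
          using False signs by (simp add: deformed_nb_def)
      qed
    qed simp
  qed
qed

lemma deformed_nb_closed:
  fixes s :: "'s \<times> ('i \<Rightarrow> 'e::linordered_ab_group_add)"
  assumes "s \<in> dual_states" "finite (UNIV :: 'i set)"
  shows "deformed_nb j s \<in> dual_states"
proof -
  obtain t v where s: "s = (t, v)"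
    by (cases s)
  obtain l :: "'i \<Rightarrow> 'e \<Rightarrow> int" where t: "t \<in> S" and add: "\<And>k. additive (l k)"
    and dual: "\<And>k i. l k (v i) = (if k = i then 1 else 0)"
    using assms by (auto simp: s dual_states_def)
  define e where "e = shift t j v"
  define d where "d i = int (b t i j) - int (b (nb i t) i j)" for i
  define v' where "v' = snd (deformed_nb j s)"
  have v'_j: "v' j = - v j"
    by (simp add: v'_def s)
  have l_minus: "l k (- x) = - l k x" for k x
    by (rule additive.minus[OF add])
  \<comment> \<open>Each \<open>e i\<close> is 0, \<open>v j\<close> or
    \<open>- v j\<close>.\<close>
  have l_e: "l k (e i) = 0" if "k \<noteq> j" for k i
    using that by (auto simp: e_def shift_def max_def l_minus dual additive.zero[OF add])
  have l_v': "l k (v' i) = (if k = i then 1 else 0) + d i * l k (e i)" if "i \<noteq> j" for k i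
    using that
    by (simp add: v'_def s deformed_nb_def e_def d_def additive.add[OF add] additive.diff[OF add]
        additive.nmul[OF add] dual left_diff_distrib)
  \<comment> \<open>\<open>- l j\<close> maps \<open>v' j\<close> to 1 but \<open>v' i\<close> to
    \<open>- d i * l j (e i)\<close>; the sum adds this back, because the \<open>l m\<close> with
    \<open>m\<close> other than \<open>j\<close> are still dual to the \<open>v' i\<close>.\<close>
  define l' where "l' k x = (if k = j then (\<Sum>m\<in>UNIV - {j}. d m * l j (e m) * l m x) - l j x else l k x)"
    for k x
  have "additive (l' k)" for k
    by unfold_locales
      (simp add: l'_def additive.add[OF add] distrib_left sum.distrib)
  moreover have "l' k (v' i) = (if k = i then 1 else 0)" for k i
  proof (cases "k = j")
    case k: True
    show ?thesis
    proof (cases "i = j")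
      case True
      have "(\<Sum>m\<in>UNIV - {j}. d m * l j (e m) * l m (v' j)) = 0"
        by (intro sum.neutral) (simp add: v'_j l_minus dual)
      then show ?thesis
        by (simp add: l'_def k True v'_j l_minus dual)
    next
      case False
      have "(\<Sum>m\<in>UNIV - {j}. d m * l j (e m) * l m (v' i)) =
          (\<Sum>m\<in>UNIV - {j}. if m = i then d m * l j (e m) else 0)"
        using False by (intro sum.cong refl) (simp add: l_v' l_e)
      also have "\<dots> = d i * l j (e i)"
        using False assms(2) by simp
      finally show ?thesis
        using False by (simp add: l'_def k l_v')
    qed
  next
    case False
    then show ?thesis
      by (cases "i = j") (simp_all add: l'_def v'_j l_minus dual l_v' l_e)
  qed
  ultimately have "(nb j t, v') \<in> dual_states"
    unfolding dual_states_def using t nb_closed by blast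
  then show ?thesis
    by (simp add: v'_def s deformed_nb_def)
qed

lemma mutation_pattern_deformed:
  assumes "finite (UNIV :: 'i set)"
  shows "mutation_pattern deformed_nb deformed_q deformed_b
    (dual_states :: ('s \<times> ('i \<Rightarrow> 'e::linordered_ab_group_add)) set) deformed_mon"
proof
  fix s :: "'s \<times> ('i \<Rightarrow> 'e)" and i j k :: 'i and h
  show "deformed_mon s i = exponent_vector (deformed_q s i) (deformed_b s i)"
    by (rule deformed_mon_def)
  assume s: "s \<in> dual_states"
  then have t: "fst s \<in> S"
    by (auto simp: dual_states_def)
  show "deformed_nb i s \<in> dual_states"
    by (rule deformed_nb_closed[OF s assms])
  show "deformed_nb i (deformed_nb i s) = s"
    by (rule deformed_nb_deformed_nb[OF t])
  show "deformed_b s i i = 0"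
    by (simp add: deformed_b_def b_self[OF t])
  show "deformed_b s i k = 0 \<or> deformed_b (deformed_nb i s) i k = 0"
    using b_disjoint[OF t] by (simp add: deformed_b_def)
  assume ij: "i \<noteq> j"
  show "deformed_b s j i \<noteq> 0 \<or> deformed_b (deformed_nb j s) j i \<noteq> 0"
    if "deformed_b s i j \<noteq> deformed_b (deformed_nb i s) i j"
    using b_exchange[OF t ij] that by (simp add: deformed_b_def)
  show "\<exists>l :: 'c \<times> 'e \<Rightarrow> int. additive l \<and> l (deformed_q s i) = l (deformed_q (deformed_nb i s) i) \<and>
      l (deformed_q s j) \<noteq> l (deformed_q (deformed_nb j s) j)"
  proof -
    \<comment> \<open>The functional dual to \<open>v j\<close> vanishes on \<open>v i\<close>, and
      these are the differences of the generic exponents across the two edges.\<close>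
    obtain l :: "'i \<Rightarrow> 'e \<Rightarrow> int" where add: "additive (l j)"
      and dual: "\<And>i. l j (snd s i) = (if j = i then 1 else 0)"
      using s unfolding dual_states_def by fastforce
    have "l j (max (snd s m) 0) - l j (max (- snd s m) 0) = (if j = m then 1 else 0)" for m
      by (simp add: max_minus_max dual flip: additive.diff[OF add])
    then have eq: "l j (max (snd s m) 0) = l j (max (- snd s m) 0) + (if j = m then 1 else 0)" for m
      by (simp add: diff_eq_eq add.commute)
    have "l j (max (snd s i) 0) = l j (max (- snd s i) 0)" "l j (max (snd s j) 0) \<noteq> l j (max (- snd s j) 0)"
      using ij by (simp_all add: eq)
    moreover have "additive (\<lambda>x :: 'c \<times> 'e. l j (snd x))"
      using add by (simp add: additive_def)
    ultimately show ?thesis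
      by (intro exI[of _ "\<lambda>x. l j (snd x)"]) (simp add: deformed_q_def)
  qed
  assume h: "h = (if deformed_b s j i = 0 then deformed_mon s j else deformed_mon (deformed_nb j s) j)
    - unit_vector j - unit_vector j"
  define h' where "h' = (if b (fst s) j i = 0 then mon (fst s) j else mon (nb j (fst s)) j)
    - unit_vector j - unit_vector j"
  \<comment> \<open>\<open>r\<close> forgets the generic coefficients. The relation splits into that
    of the given pattern and one between generic exponents.\<close>
  define r where "r = (\<lambda>g :: ('c \<times> 'e) \<times> ('i \<Rightarrow> int). (fst (fst g), snd g))"
  have r_add: "r (x + y) = r x + r y" and r_nmul: "r (nmul n x) = nmul n (r x)" for x y n
    by (simp_all add: r_def nmul_Pair)
  have r_mon: "r (deformed_mon s' m) = mon (fst s') m" for s' m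
    by (simp add: r_def deformed_mon_def deformed_q_def deformed_b_def mon_eq exponent_vector_def)
  have r_h: "r h = h'"
    by (simp add: h h'_def deformed_b_def)
      (simp add: r_def deformed_mon_def deformed_q_def deformed_b_def mon_eq exponent_vector_def unit_vector_def)
  let ?lhs = "deformed_mon (deformed_nb j s) i + deformed_mon (deformed_nb i s) i +
      nmul (deformed_b (deformed_nb i s) i j) h"
  let ?rhs = "deformed_mon (deformed_nb i (deformed_nb j s)) i + deformed_mon s i +
      nmul (deformed_b s i j) h"
  have "r ?lhs = r ?rhs"
    using mon_exchange[OF t ij h'_def] by (simp add: r_add r_nmul r_mon r_h deformed_b_def)
  moreover have "snd (fst ?lhs) = snd (fst ?rhs)"
  proof -
    have e_mon: "snd (fst (deformed_mon s' m)) = max (snd s' m) 0" for s' m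
      by (simp add: deformed_mon_def exponent_vector_def deformed_q_def)
    have e_h: "snd (fst h) = shift (fst s) j (snd s) i"
      by (simp add: h deformed_b_def e_mon shift_def)
    let ?e = "shift (fst s) j (snd s) i"
    define w where "w = snd (deformed_nb j s) i"
    have "w + nmul (b (nb i (fst s)) i j) ?e = snd s i + nmul (b (fst s) i j) ?e"
      using ij by (simp add: w_def deformed_nb_def)
    then have "max w 0 + max (- snd s i) 0 + nmul (b (nb i (fst s)) i j) ?e =
        max (- w) 0 + max (snd s i) 0 + nmul (b (fst s) i j) ?e"
      using max_minus_max[of w] max_minus_max[of "snd s i"] by (simp add: algebra_simps)
    then show ?thesis
      by (simp add: e_mon e_h deformed_b_def flip: w_def)
  qed
  ultimately show "?lhs = ?rhs"
    by (simp only: r_def prod_eq_iff fst_conv snd_conv)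
qed

end

section \<open>Specialization\<close>

context mutation_pattern
begin

lemma mutate_other: "k \<noteq> i \<Longrightarrow> mutate s i \<chi> (unit_vector k) = \<chi> (unit_vector k)"
  by (simp add: mutate_def twist_def)

lemma mutate_coefficient: "mutate s i \<chi> (c, 0) = \<chi> (c, 0)"
  by (simp add: mutate_def twist_def)

lemma mutate_exchange:
  assumes "character \<chi>"
  shows "\<chi> (unit_vector i) * mutate s i \<chi> (unit_vector i) = \<chi> (mon s i) + \<chi> (mon (nb i s) i)"
proof -
  have "\<chi> (unit_vector i) * \<chi> (unit_vector i) * \<chi> (g - unit_vector i - unit_vector i) = \<chi> g" for g
    by (simp flip: character_add[OF assms])
  then show ?thesis
    by (simp add: mutate_def twist_def ratio_def ev_add distrib_left flip: mult.assoc)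
qed

lemma run_snoc: "run (w @ [i]) s \<chi> = mutate (fold nb w s) i (run w s \<chi>)"
  by (induction w arbitrary: s \<chi>) simp_all

lemma free_character_run: "s \<in> S \<Longrightarrow> free_character \<chi> \<Longrightarrow> free_character (run w s \<chi>)"
  by (induction w arbitrary: s \<chi>) (simp_all add: nb_closed free_character_mutate)

lemma run_coefficient: "run w s \<chi> (c, 0) = \<chi> (c, 0)"
  by (induction w arbitrary: s \<chi>) (simp_all add: mutate_coefficient)

text \<open>
  The exchange relations between the Laurent expansions hold in the group ring, so every
  character maps them to exchange relations.
\<close>

lemma ev_run_specialize:
  fixes y :: "'i list \<Rightarrow> 'i \<Rightarrow> 'k::field"
  assumes fin: "finite (UNIV :: 'i set)" and s: "s \<in> S" and \<chi>: "free_character \<chi>"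
    and \<psi>: "character \<psi>"
    and y_Nil: "\<And>k. y [] k = \<psi> (unit_vector k)"
    and y_nonzero: "\<And>w k. y w k \<noteq> 0"
    and y_other: "\<And>w i k. k \<noteq> i \<Longrightarrow> y (w @ [i]) k = y w k"
    and y_exchange: "\<And>w i. y w i * y (w @ [i]) i =
      (let t = fold nb w s; u = nb i t in
        \<psi> (q t i, 0) * (\<Prod>k\<in>UNIV. y w k ^ b t i k) + \<psi> (q u i, 0) * (\<Prod>k\<in>UNIV. y w k ^ b u i k))"
  shows "run w s \<chi> (unit_vector k) = ev \<chi> f \<Longrightarrow> ev \<psi> f = y w k"
proof (induction w arbitrary: k f rule: rev_induct)
  case Nil
  then have "ev \<chi> f = ev \<chi> (frag_of (unit_vector k))"
    by simp
  then have "f = frag_of (unit_vector k)"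
    by (simp only: free_character_ev_inject[OF \<chi>])
  then show ?case
    by (simp add: y_Nil)
next
  case (snoc i w)
  note char = free_characterD[OF \<chi>]
  let ?t = "fold nb w s"
  let ?\<chi> = "run w s \<chi>"
  have free: "free_character ?\<chi>"
    by (rule free_character_run[OF s \<chi>])
  have "\<exists>F. \<forall>m. ?\<chi> (unit_vector m) = ev \<chi> (F m)"
    using laurent_phenomenon[OF s \<chi>, of w] by (intro choice) blast
  then obtain F where F: "\<And>m. ?\<chi> (unit_vector m) = ev \<chi> (F m)"
    by blast
  have ev_F: "ev \<psi> (F m) = y w m" for m
    by (rule snoc.IH[OF F])
  have prod: "ev \<theta> (\<Prod>m\<in>UNIV. F m ^ n m) = (\<Prod>m\<in>UNIV. ev \<theta> (F m) ^ n m)" if "character \<theta>"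
    for \<theta> :: "'c \<times> ('i \<Rightarrow> int) \<Rightarrow> 'm::field" and n
    using fin by (induction rule: finite_induct) (simp_all add: ev_one ev_mult ev_power that)
  show ?case
  proof (cases "k = i")
    case False
    then have "?\<chi> (unit_vector k) = ev \<chi> f"
      using snoc.prems by (simp add: run_snoc mutate_other)
    then show ?thesis
      using snoc.IH False by (simp add: y_other)
  next
    case True
    \<comment> \<open>\<open>E u\<close> is the Laurent expansion of the exchange monomial at
      \<open>u\<close>, assembled from the expansions \<open>F\<close> of the variables.\<close>
    define E where "E u = frag_of (q u i, 0) * (\<Prod>m\<in>UNIV. F m ^ b u i m)" for u
    have mon_E: "?\<chi> (mon u i) = ev \<chi> (E u)" for u
      by (simp add: mon_eq character_exponent_vector[OF free_characterD[OF free] fin] run_coefficient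
          F E_def ev_mult[OF char] prod[OF char])
    have ev_E: "ev \<psi> (E u) = \<psi> (q u i, 0) * (\<Prod>m\<in>UNIV. y w m ^ b u i m)" for u
      by (simp add: E_def ev_mult[OF \<psi>] prod[OF \<psi>] ev_F)
    have "ev \<chi> (F i * f) = ev \<chi> (E ?t + E (nb i ?t))"
      using mutate_exchange[OF free_characterD[OF free], of i ?t] snoc.prems
      by (simp add: True run_snoc F mon_E ev_add ev_mult[OF char])
    then have "F i * f = E ?t + E (nb i ?t)"
      by (simp only: free_character_ev_inject[OF \<chi>])
    then have "ev \<psi> (F i * f) = ev \<psi> (E ?t + E (nb i ?t))"
      by simp
    then have "y w i * ev \<psi> f = y w i * y (w @ [i]) i"
      by (simp add: ev_mult[OF \<psi>] ev_add ev_E ev_F y_exchange Let_def)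
    then show ?thesis
      using y_nonzero by (simp add: True)
  qed
qed

end

section \<open>Cluster algebras\<close>

lemma ring_morphism_monomial_at:
  fixes f :: "'f::field \<Rightarrow> 'k::field"
  assumes "ring_morphism f"
  shows "f (monomial_at \<iota> y m) = monomial_at (\<lambda>a. f (\<iota> a)) (\<lambda>i. f (y i)) m"
  by (simp add: monomial_at_def power_product_def ring_morphism_mult[OF assms]
      ring_morphism_prod[OF assms] ring_morphism_power[OF assms])

locale cluster_structure =
  labelled_regular_tree edge + rational_function_field \<iota> X + exchange_pattern edge \<iota> X M +
  transition_maps edge \<iota> X M R + ambient_field edge \<iota> R \<kappa> \<phi>
  for edge :: "'v \<Rightarrow> 'i::finite \<Rightarrow> 'v \<Rightarrow> bool"
    and \<iota> :: "'p::ab_group_add group_ring \<Rightarrow> 'f::field"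
    and X :: "'i \<Rightarrow> 'f"
    and M :: "'v \<Rightarrow> 'i \<Rightarrow> ('p, 'i) monomial"
    and R :: "'v \<Rightarrow> 'v \<Rightarrow> 'f \<Rightarrow> 'f"
    and \<kappa> :: "'p group_ring \<Rightarrow> 'k::field"
    and \<phi> :: "'v \<Rightarrow> 'f \<Rightarrow> 'k"
begin

section \<open>Vertices, monomials and exchange relations of the given pattern\<close>

definition neighbour :: "'i \<Rightarrow> 'v \<Rightarrow> 'v" where
  "neighbour j t = (THE t'. edge t j t')"

definition coef :: "'v \<Rightarrow> 'i \<Rightarrow> 'p" where
  "coef t i = fst (M t i)"

definition expo :: "'v \<Rightarrow> 'i \<Rightarrow> 'i \<Rightarrow> nat" where
  "expo t i = Poly_Mapping.lookup (snd (M t i))"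

definition mon :: "'v \<Rightarrow> 'i \<Rightarrow> 'p \<times> ('i \<Rightarrow> int)" where
  "mon t i = exponent_vector (coef t i) (expo t i)"

lemma edge_neighbour: "edge t j (neighbour j t)"
  unfolding neighbour_def by (rule theI'[OF regular])

lemma edge_iff: "edge t j t' \<longleftrightarrow> t' = neighbour j t"
  using regular[of t j] edge_neighbour by blast

lemma neighbour_neighbour [simp]: "neighbour j (neighbour j t) = t"
  using edge_sym[OF edge_neighbour] by (simp add: edge_iff)

lemma ex_walk: "\<exists>w. fold neighbour w t = t'"
  using connected[of t t']
proof (induction rule: rtranclp_induct)
  case base
  show ?case
    by (rule exI[of _ "[]"]) simp
next
  case (step u v)
  obtain w where "fold neighbour w t = u"
    using step.IH by blast
  moreover obtain j where "v = neighbour j u"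
    using step.hyps(2) edge_iff unfolding adjacent_def by blast
  ultimately show ?case
    by (intro exI[of _ "w @ [j]"]) simp
qed

abbreviation L :: "'p \<times> ('i \<Rightarrow> int) \<Rightarrow> 'f" where
  "L \<equiv> laurent_character \<iota> X"

lemmas free_L = free_laurent_character

lemmas character_L = free_characterD[OF free_L]

lemma monomial_at_L: "monomial_at \<iota> X (M t i) = L (mon t i)"
  by (simp add: monomial_at_eq_laurent_character mon_def coef_def expo_def)

lemma monomial_at_upd_zero:
  "monomial_at \<iota> (X(i := 0)) (M t j) = (if expo t j i = 0 then L (mon t j) else 0)"
  by (simp add: monomial_at_L[symmetric] monomial_at_def power_product_def expo_def
      prod.remove[of UNIV i])

lemma monomial_at_upd:
  "monomial_at \<iota> (X(j := z)) (M t i) = L (mon t i) * (z / X j) ^ expo t i j"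
  using variable_nonzero[of j]
  by (simp add: monomial_at_L[symmetric] monomial_at_def power_product_def expo_def
      prod.remove[of UNIV j] power_divide)

text \<open>\<open>M\<^sub>0 / x\<^sub>j\<^sup>2\<close> of axiom E4\<close>

definition substituted :: "'v \<Rightarrow> 'i \<Rightarrow> 'i \<Rightarrow> ('p \<times> ('i \<Rightarrow> int)) \<Rightarrow>\<^sub>0 int" where
  "substituted t j i =
    (if expo t j i = 0 then frag_of (mon t j - unit_vector j - unit_vector j) else 0) +
    (if expo (neighbour j t) j i = 0 then frag_of (mon (neighbour j t) j - unit_vector j - unit_vector j) else 0)"

lemma expo_self: "expo t i i = 0"
  using E1[of i t] by (simp add: var_dvd_def expo_def)

lemma expo_disjoint: "expo t i k = 0 \<or> expo (neighbour i t) i k = 0"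
  using E2[OF edge_neighbour, of k t i] unfolding var_dvd_def expo_def neq0_conv[symmetric] by blast

lemma augmentation_substituted:
  "ev (\<lambda>_. 1 :: int) (substituted t j i) =
    (if expo t j i = 0 \<and> expo (neighbour j t) j i = 0 then 2 else 1)"
  using expo_disjoint[of t j i] by (auto simp: substituted_def ev_add)

lemma substituted_nonzero: "substituted t j i \<noteq> 0"
  using augmentation_substituted[of t j i] by (auto split: if_splits)

text \<open>Axiom E4 along the walk from \<open>neighbour i t\<close> through \<open>t\<close> and
  \<open>neighbour j t\<close>. With denominators cleared, both sides are values of
  \<open>ev L\<close>, whose injectivity gives the identity in the group ring.\<close>

lemma exchange_relation:
  assumes "i \<noteq> j"
  shows "frag_of (mon (neighbour j t) i + mon (neighbour i t) i) * substituted t j i ^ expo (neighbour i t) i j =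
    frag_of (mon (neighbour i (neighbour j t)) i + mon t i) * substituted t j i ^ expo t i j"
proof -
  let ?s = "neighbour i t" and ?u = "neighbour j t"
  let ?v = "neighbour i ?u"
  define M0 where "M0 = monomial_at \<iota> (X(i := 0)) (M t j) + monomial_at \<iota> (X(i := 0)) (M ?u j)"
  define r where "r = ev L (substituted t j i)"
  have r_nz: "r \<noteq> 0"
    by (simp add: r_def free_character_ev_eq_0_iff[OF free_L] substituted_nonzero)
  have L_unit: "L (unit_vector j) = X j"
    by (simp add: laurent_character_def unit_vector_def ring_morphism_one[OF coefficient_embedding]
        if_distrib cong: if_cong)
  have r: "M0 / X j / X j = r"
    by (simp add: M0_def r_def substituted_def monomial_at_upd_zero ev_add character_diff[OF character_L]
        L_unit add_divide_distrib)
  have nz: "L g \<noteq> 0" for g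
    by (rule character_nonzero[OF character_L])
  have "edge ?s i t" "edge t j ?u" "edge ?u i ?v"
    by (simp_all add: edge_iff)
  from E4[OF this assms M0_def]
  have "L (mon ?u i) / L (mon ?v i) = (L (mon t i) * r ^ expo t i j) / (L (mon ?s i) * r ^ expo ?s i j)"
    by (simp only: monomial_at_L monomial_at_upd r)
  then have "L (mon ?u i) * L (mon ?s i) * r ^ expo ?s i j = L (mon ?v i) * L (mon t i) * r ^ expo t i j"
    using nz r_nz by (simp add: field_simps)
  then have "ev L (frag_of (mon ?u i + mon ?s i) * substituted t j i ^ expo ?s i j) =
      ev L (frag_of (mon ?v i + mon t i) * substituted t j i ^ expo t i j)"
    by (simp add: ev_mult[OF character_L] ev_power[OF character_L] character_add[OF character_L] r_def)
  then show ?thesis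
    by (simp only: free_character_ev_inject[OF free_L])
qed

text \<open>
  If \<open>M\<^sub>0\<close> is a binomial, comparing the sums of the coefficients on both sides of the exchange
  relation shows that \<open>x\<^sub>j\<close> occurs in neither of the two monomials it is substituted into.
\<close>

lemma expo_exchange:
  assumes "i \<noteq> j" "expo t i j \<noteq> expo (neighbour i t) i j"
  shows "expo t j i \<noteq> 0 \<or> expo (neighbour j t) j i \<noteq> 0"
proof (rule ccontr)
  assume "\<not> ?thesis"
  then have "ev (\<lambda>_. 1 :: int) (substituted t j i) = 2"
    by (simp add: augmentation_substituted)
  moreover have char: "character (\<lambda>_ :: 'p \<times> ('i \<Rightarrow> int). 1 :: int)"
    by (simp add: character_def)
  ultimately have "(2 :: int) ^ expo (neighbour i t) i j = 2 ^ expo t i j"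
    using arg_cong[OF exchange_relation[OF assms(1), of t], of "ev (\<lambda>_. 1 :: int)"]
    by (simp only: ev_mult[OF char] ev_power[OF char] ev_single of_int_1 mult_1)
  then show False
    using assms(2) by simp
qed

lemma monomial_pattern: "monomial_pattern neighbour coef expo UNIV mon"
proof
  fix t i j h
  assume ij: "i \<noteq> (j :: 'i)"
    and h: "h = (if expo t j i = 0 then mon t j else mon (neighbour j t) j) - unit_vector j - unit_vector j"
  let ?s = "neighbour i t" and ?u = "neighbour j t"
  let ?v = "neighbour i ?u"
  show "mon ?u i + mon ?s i + nmul (expo ?s i j) h = mon ?v i + mon t i + nmul (expo t i j) h"
  \<comment> \<open>If \<open>M0\<close> is a binomial, its powers on the two sides agree and
    cancel; otherwise it is a single monomial and the relation is one between group
    elements.\<close>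
  proof (cases "expo t j i = 0 \<and> expo ?u j i = 0")
    case True
    then have eq: "expo t i j = expo ?s i j"
      using expo_exchange[OF ij, of t] by auto
    have "ev L (substituted t j i) \<noteq> 0"
      by (simp add: free_character_ev_eq_0_iff[OF free_L] substituted_nonzero)
    then have "L (mon ?u i + mon ?s i) = L (mon ?v i + mon t i)"
      using arg_cong[OF exchange_relation[OF ij, of t], of "ev L"] eq
      by (simp add: ev_mult[OF character_L] ev_power[OF character_L])
    then show ?thesis
      using eq by (simp add: free_character_inject[OF free_L])
  next
    case False
    then have "substituted t j i = frag_of h"
      using expo_disjoint[of t j i] by (auto simp: substituted_def h)
    then have "frag_of (mon ?u i + mon ?s i + nmul (expo ?s i j) h) = frag_of (mon ?v i + mon t i + nmul (expo t i j) h)"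
      using exchange_relation[OF ij, of t] by (simp only: frag_of_nmul frag_of_add)
    then have "L (mon ?u i + mon ?s i + nmul (expo ?s i j) h) = L (mon ?v i + mon t i + nmul (expo t i j) h)"
      by (simp flip: free_character_ev_inject[OF free_L])
    then show ?thesis
      by (simp only: free_character_inject[OF free_L])
  qed
qed (use expo_self expo_disjoint expo_exchange in \<open>auto simp: mon_def\<close>)

section \<open>Cluster variables in the ambient field\<close>

definition cluster_var :: "'v \<Rightarrow> 'i \<Rightarrow> 'k" where
  "cluster_var t i = \<phi> t (X i)"

lemma cluster_var_nonzero: "cluster_var t i \<noteq> 0"
  using bij_is_inj[OF \<phi>_bij, of t] variable_nonzero[of i]
  by (metis injD ring_morphism_zero[OF \<phi>_morphism] cluster_var_def)

lemma \<phi>_monomial_at: "\<phi> t (monomial_at \<iota> X m) = monomial_at \<kappa> (cluster_var t) m"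
  by (simp add: ring_morphism_monomial_at[OF \<phi>_morphism] \<phi>_linear cluster_var_def[abs_def])

lemma cluster_var_other: "i \<noteq> j \<Longrightarrow> cluster_var (neighbour j t) i = cluster_var t i"
  using \<phi>_transition[OF edge_neighbour, of t j "X i"] R_other[OF edge_neighbour, of i j t]
  by (simp add: cluster_var_def)

lemma cluster_var_exchange:
  "cluster_var t j * cluster_var (neighbour j t) j = monomial_at \<kappa> (cluster_var t) (M t j) + monomial_at \<kappa> (cluster_var t) (M (neighbour j t) j)"
proof -
  let ?u = "neighbour j t"
  have "X j * ((monomial_at \<iota> X (M t j) + monomial_at \<iota> X (M ?u j)) / X j) =
      monomial_at \<iota> X (M t j) + monomial_at \<iota> X (M ?u j)"
    using variable_nonzero by simp
  from arg_cong[OF this, of "\<phi> t"] show ?thesis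
    using \<phi>_transition[OF edge_neighbour, of t j "X j"]
    by (simp only: ring_morphism_mult[OF \<phi>_morphism] ring_morphism_add[OF \<phi>_morphism]
        \<phi>_monomial_at R_exchange[OF edge_neighbour] cluster_var_def)
qed

lemma \<kappa>_morphism: "ring_morphism \<kappa>"
proof -
  obtain t :: 'v where True
    by blast
  have "\<kappa> = (\<lambda>a. \<phi> t (\<iota> a))"
    by (simp add: \<phi>_linear)
  then show ?thesis
    using \<phi>_morphism[of t] coefficient_embedding unfolding ring_morphism_def by simp
qed

theorem cluster_var_mem_laurent_ring: "cluster_var t j \<in> laurent_ring \<kappa> (cluster_var t\<^sub>0)"
proof -
  interpret base: monomial_pattern neighbour coef expo UNIV mon
    by (rule monomial_pattern)
  have fin: "finite (UNIV :: 'i set)"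
    by simp
  \<comment> \<open>The labels need not be linearly ordered. Encoded as natural numbers, they index
    coordinates of a linearly ordered group of generic coefficients.\<close>
  obtain enc :: "'i \<Rightarrow> nat" where enc: "inj enc"
    using finite_imp_inj_to_nat_seg[OF fin] by blast
  define v0 :: "'i \<Rightarrow> nat \<Rightarrow>\<^sub>0 int" where "v0 i = Poly_Mapping.single (enc i) 1" for i
  define s0 where "s0 = (t\<^sub>0, v0)"
  interpret deformed: mutation_pattern base.deformed_nb base.deformed_q base.deformed_b
    "base.dual_states :: ('v \<times> ('i \<Rightarrow> nat \<Rightarrow>\<^sub>0 int)) set" base.deformed_mon
    by (rule base.mutation_pattern_deformed[OF fin])
  \<comment> \<open>The functionals dual to the initial vectors are the coordinates at
    \<open>enc k\<close>.\<close>
  have s0: "s0 \<in> base.dual_states"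
    unfolding s0_def base.dual_states_def
    by (auto intro!: exI[of _ "\<lambda>k e. Poly_Mapping.lookup e (enc k)"]
        simp: additive_def lookup_add v0_def lookup_single when_def inj_eq[OF enc])
  let ?\<chi> = "extended_character L :: ('p \<times> (nat \<Rightarrow>\<^sub>0 int)) \<times> ('i \<Rightarrow> int) \<Rightarrow> ((nat \<Rightarrow>\<^sub>0 int) \<Rightarrow>\<^sub>0 'f) fract"
  have \<chi>: "free_character ?\<chi>"
    by (rule free_extended_character[OF free_L])
  \<comment> \<open>\<open>\<psi>\<close> sets all generic coefficients to 1 and evaluates at the
    cluster of \<open>t\<^sub>0\<close>.\<close>
  define \<psi> :: "('p \<times> (nat \<Rightarrow>\<^sub>0 int)) \<times> ('i \<Rightarrow> int) \<Rightarrow> 'k"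
    where "\<psi> g = laurent_character \<kappa> (cluster_var t\<^sub>0) (fst (fst g), snd g)" for g
  have "character (laurent_character \<kappa> (cluster_var t\<^sub>0))"
    by (rule character_laurent_character[OF \<kappa>_morphism cluster_var_nonzero])
  then have "character \<psi>"
    unfolding character_def \<psi>_def by (simp flip: add_Pair add: zero_prod_def)
  obtain w where w: "fold neighbour w t\<^sub>0 = t"
    using ex_walk by blast
  have fst_fold: "fst (fold base.deformed_nb w' s) = fold neighbour w' (fst s)" for w' and s :: "'v \<times> ('i \<Rightarrow> nat \<Rightarrow>\<^sub>0 int)"
    by (induction w' arbitrary: s) simp_all
  have \<psi>_coef: "\<psi> ((c, e), 0) = \<kappa> (frag_of c)" for c e
    by (simp add: \<psi>_def laurent_character_def)
  obtain f where f: "deformed.run w s0 ?\<chi> (unit_vector j) = ev ?\<chi> f"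
    using deformed.laurent_phenomenon[OF s0 \<chi>] by blast
  have "ev \<psi> f = cluster_var (fold neighbour w t\<^sub>0) j"
  proof (rule deformed.ev_run_specialize[OF fin s0 \<chi> \<open>character \<psi>\<close> _ _ _ _ f,
      of "\<lambda>w. cluster_var (fold neighbour w t\<^sub>0)"])
    show "cluster_var (fold neighbour [] t\<^sub>0) k = \<psi> (unit_vector k)" for k
      by (simp add: \<psi>_def laurent_character_def unit_vector_def ring_morphism_one[OF \<kappa>_morphism]
          if_distrib cong: if_cong)
    show "cluster_var (fold neighbour w' t\<^sub>0) k \<noteq> 0" for w' k
      by (rule cluster_var_nonzero)
    show "cluster_var (fold neighbour (w' @ [i]) t\<^sub>0) k = cluster_var (fold neighbour w' t\<^sub>0) k" if "k \<noteq> i" for w' i k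
      using that by (simp add: cluster_var_other)
    show "cluster_var (fold neighbour w' t\<^sub>0) i * cluster_var (fold neighbour (w' @ [i]) t\<^sub>0) i =
      (let t = fold base.deformed_nb w' s0; u = base.deformed_nb i t in
        \<psi> (base.deformed_q t i, 0) * (\<Prod>k\<in>UNIV. cluster_var (fold neighbour w' t\<^sub>0) k ^ base.deformed_b t i k) +
        \<psi> (base.deformed_q u i, 0) * (\<Prod>k\<in>UNIV. cluster_var (fold neighbour w' t\<^sub>0) k ^ base.deformed_b u i k))" for w' i
      by (simp add: cluster_var_exchange Let_def base.deformed_q_def base.deformed_b_def \<psi>_coef fst_fold s0_def
          monomial_at_def power_product_def coef_def expo_def)
  qed
  moreover have "ev \<psi> f \<in> laurent_ring \<kappa> (cluster_var t\<^sub>0)"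
    by (rule laurent_character_mem_laurent_ring[OF \<kappa>_morphism]) (simp add: \<psi>_def)
  ultimately show ?thesis
    by (simp add: w)
qed

end

theorem theorem3p1:
  fixes edge :: "'v \<Rightarrow> 'i::finite \<Rightarrow> 'v \<Rightarrow> bool"
    and \<iota> :: "'p::torsion_free_ab_group_add group_ring \<Rightarrow> 'f::field"
    and X :: "'i \<Rightarrow> 'f"
    and M :: "'v \<Rightarrow> 'i \<Rightarrow> ('p, 'i) monomial"
    and R :: "'v \<Rightarrow> 'v \<Rightarrow> 'f \<Rightarrow> 'f"
    and \<kappa> :: "'p group_ring \<Rightarrow> 'k::field"
    and \<phi> :: "'v \<Rightarrow> 'f \<Rightarrow> 'k"
    and x :: "'v \<Rightarrow> 'i \<Rightarrow> 'k"
    and \<A> :: "'p group_ring set"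
    and alg :: "'k set"
  assumes "labelled_regular_tree edge"
    and "rational_function_field \<iota> X"
    and "exchange_pattern edge \<iota> X M"
    and "transition_maps edge \<iota> X M R"
    and "ambient_field edge \<iota> R \<kappa> \<phi>"
    and "x = cluster_variable X \<phi>"
    and "unital_subring \<A>"
    and "\<forall>t i. Poly_Mapping.single (fst (M t i)) 1 \<in> \<A>"
    and "alg = cluster_algebra \<kappa> \<A> x"
  shows "\<forall>t\<^sub>0 t j. x t j \<in> laurent_ring \<kappa> (x t\<^sub>0)"
proof -
  interpret cluster_structure edge \<iota> X M R \<kappa> \<phi>
    using assms(1-5) by (intro cluster_structure.intro)
  have "x = cluster_structure.cluster_var X \<phi>"
    by (simp add: assms(6) cluster_variable_def cluster_var_def fun_eq_iff)
  then show ?thesis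
    using cluster_var_mem_laurent_ring by simp
qed

end
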